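(* Let $D_1$ be the open unit ball of $\mathbb{R}^2$. For all $k\in\mathbb{N}$ and $\kappa>0$, the (positive) roots of $$F_k(\alpha):=\frac{\kappa}{\alpha}J_k(\alpha)I_k'\Bigl(\frac{\kappa}{\alpha}\Bigr)-\alpha I_k\Bigl(\frac{\kappa}{\alpha}\Bigr)J_k'(\alpha),\qquad \alpha>0,$$ are simple and can be ordered as an increasing sequence $\alpha_{k,\ell}=\alpha_{k,\ell}(\kappa)>0$, with $\ell\in\mathbb{N}^*$, such that $$\forall \ell>0,\qquad j_{k,\ell}<\alpha_{k,\ell}<j_{k+1,\ell}.$$ Each $\ell>0$ gives rise to the eigenvalue $$\lambda_{k,\ell}=\alpha_{k,\ell}^2-\frac{\kappa^2}{\alpha_{k,\ell}^2}$$ of the problem $$\Delta^2u-\kappa^2u=-\lambda\Delta u\ \text{ in }D_1,\qquad u=\partial_ru=0\ \text{ on }\partial D_1,$$ and to corresponding eigenfunctions of the form (in polar coordinates) $R_{k,\ell}(r)\,e^{\pm \mathbf{i}k\theta}$ with $$R_{k,\ell}(r)=c\,J_k(\alpha_{k,\ell}\,r)+d\,I_k\Bigl(\frac{\kappa}{\alpha_{k,\ell}}\,r\Bigr),$$ where $(c,d)$ is a nontrivial solution to the linear system $$\begin{cases} c\,J_k(\alpha)+d\,I_k(\kappa/\alpha)=0,\\ c\,\alpha J_k'(\alpha)+d\,\frac{\kappa}{\alpha}I_k'(\kappa/\alpha)=0,\end{cases}\qquad\text{with }\alpha=\alpha_{k,\ell}.$$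
   Context: $\mathbb{N}=\{0,1,2,\dots\}$, $\mathbb{N}^*=\{1,2,\dots\}$. $J_k$ (resp. $I_k$) is the Bessel function (resp. modified Bessel function) of the first kind of order $k$, and $(j_{k,\ell})_{\ell\ge1}$ are the positive roots of $J_k$ in increasing order. An eigenvalue is a $\lambda\in\mathbb{R}$ for which the boundary value problem has a nontrivial solution. *)

theory Defs
  imports "HOL-Analysis.Analysis"
begin

definition bessel_J :: "nat \<Rightarrow> real \<Rightarrow> real" where
  "bessel_J k x = (\<Sum>m. (-1) ^ m / (fact m * fact (m + k)) * (x / 2) ^ (2 * m + k))"

definition bessel_I :: "nat \<Rightarrow> real \<Rightarrow> real" where
  "bessel_I k x = (\<Sum>m. 1 / (fact m * fact (m + k)) * (x / 2) ^ (2 * m + k))"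

text \<open>The \<open>l\<close>-th positive root of \<open>J\<^sub>k\<close>, for \<open>l \<ge> 1\<close>: the root with exactly \<open>l\<close>
  roots in the interval from 0 (excluded) to itself (included).
  The value at \<open>l = 0\<close> is meaningless.\<close>

definition bessel_J_root :: "nat \<Rightarrow> nat \<Rightarrow> real" where
  "bessel_J_root k l =
    (THE x. 0 < x \<and> bessel_J k x = 0 \<and> card {y. 0 < y \<and> y \<le> x \<and> bessel_J k y = 0} = l)"

definition F_fun :: "nat \<Rightarrow> real \<Rightarrow> real \<Rightarrow> real" where
  "F_fun k \<kappa> \<alpha> = \<kappa> / \<alpha> * bessel_J k \<alpha> * deriv (bessel_I k) (\<kappa> / \<alpha>)
     - \<alpha> * bessel_I k (\<kappa> / \<alpha>) * deriv (bessel_J k) \<alpha>"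

definition partial_deriv ::
  "'a::euclidean_space \<Rightarrow> ('a \<Rightarrow> 'b::real_normed_vector) \<Rightarrow> 'a \<Rightarrow> 'b" where
  "partial_deriv b u x = frechet_derivative u (at x) b"

definition laplacian :: "('a::euclidean_space \<Rightarrow> 'b::real_normed_vector) \<Rightarrow> 'a \<Rightarrow> 'b" where
  "laplacian u x = (\<Sum>b\<in>Basis. partial_deriv b (partial_deriv b u) x)"

text \<open>\<open>n\<close> times continuously differentiable; meant for open \<open>S\<close>.\<close>

primrec Cn_on ::
  "nat \<Rightarrow> 'a::euclidean_space set \<Rightarrow> ('a \<Rightarrow> 'b::real_normed_vector) \<Rightarrow> bool" where
  "Cn_on 0 S u \<longleftrightarrow> continuous_on S u"
| "Cn_on (Suc n) S u \<longleftrightarrow>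
     (\<forall>x\<in>S. u differentiable (at x)) \<and> (\<forall>b\<in>Basis. Cn_on n S (partial_deriv b u))"

text \<open>Classical solutions of class \<open>C\<^sup>4\<close> up to the boundary, i.e. on a neighbourhood of
  the closed disc. The radial derivative at a boundary point \<open>x\<close> is the derivative of
  \<open>r \<mapsto> u (r x)\<close> at \<open>r = 1\<close>.\<close>

definition is_eigenfunction :: "real \<Rightarrow> real \<Rightarrow> (real ^ 2 \<Rightarrow> complex) \<Rightarrow> bool" where
  "is_eigenfunction \<kappa> lam u \<longleftrightarrow>
     (\<exists>U. open U \<and> cball 0 1 \<subseteq> U \<and> Cn_on 4 U u) \<and>
     (\<forall>x\<in>ball 0 1. laplacian (laplacian u) x - complex_of_real (\<kappa>\<^sup>2) * u x
                    = - complex_of_real lam * laplacian u x) \<and>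
     (\<forall>x\<in>sphere 0 1. u x = 0 \<and>
        ((\<lambda>r. u (r *\<^sub>R x)) has_vector_derivative 0) (at 1)) \<and>
     (\<exists>x\<in>ball 0 1. u x \<noteq> 0)"

definition is_eigenvalue :: "real \<Rightarrow> real \<Rightarrow> bool" where
  "is_eigenvalue \<kappa> lam \<longleftrightarrow> (\<exists>u. is_eigenfunction \<kappa> lam u)"

text \<open>The function \<open>R(r) exp(im\<theta>)\<close> in polar coordinates. At the origin the angle is
  \<open>Arg 0 = 0\<close>, which is harmless since the profiles used below vanish at \<open>r = 0\<close> unless
  \<open>m = 0\<close>.\<close>

definition polar_fun :: "(real \<Rightarrow> complex) \<Rightarrow> int \<Rightarrow> real ^ 2 \<Rightarrow> complex" where
  "polar_fun R m x = R (norm x) * cis (of_int m * Arg (Complex (x $ 1) (x $ 2)))"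

definition radial_profile ::
  "nat \<Rightarrow> real \<Rightarrow> real \<Rightarrow> complex \<Rightarrow> complex \<Rightarrow> real \<Rightarrow> complex" where
  "radial_profile k \<kappa> \<alpha> c d r =
     c * complex_of_real (bessel_J k (\<alpha> * r)) + d * complex_of_real (bessel_I k (\<kappa> / \<alpha> * r))"

definition boundary_system ::
  "nat \<Rightarrow> real \<Rightarrow> real \<Rightarrow> complex \<Rightarrow> complex \<Rightarrow> bool" where
  "boundary_system k \<kappa> \<alpha> c d \<longleftrightarrow>
     c * complex_of_real (bessel_J k \<alpha>) + d * complex_of_real (bessel_I k (\<kappa> / \<alpha>)) = 0 \<and>
     c * complex_of_real (\<alpha> * deriv (bessel_J k) \<alpha>)
       + d * complex_of_real (\<kappa> / \<alpha> * deriv (bessel_I k) (\<kappa> / \<alpha>)) = 0"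

end

theory Submission imports Defs begin

text \<open>With \<open>\<beta> = \<kappa> / \<alpha>\<close> the recurrences give
  \<open>F\<^sub>k(\<alpha>) = \<beta> J\<^sub>k(\<alpha>) I\<^sub>k\<^sub>+\<^sub>1(\<beta>) + \<alpha> I\<^sub>k(\<beta>) J\<^sub>k\<^sub>+\<^sub>1(\<alpha>)\<close>, so at a zero of \<open>F\<^sub>k\<close> the values
  \<open>J\<^sub>k(\<alpha>)\<close> and \<open>J\<^sub>k\<^sub>+\<^sub>1(\<alpha>)\<close> have opposite signs. Since \<open>x J\<^sub>k\<^sub>+\<^sub>1 / J\<^sub>k\<close> is strictly increasing between
  zeros of \<open>J\<^sub>k\<close>, this happens exactly in the intervals from \<open>j\<^sub>k\<^sub>,\<^sub>l\<close> to \<open>j\<^sub>k\<^sub>+\<^sub>1\<^sub>,\<^sub>l\<close>, and \<open>F\<^sub>k\<close> changes sign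
  across each of them. At a zero, \<open>F\<^sub>k'\<close> is \<open>J\<^sub>k(\<alpha>)\<close> times a positive multiple of the Dirichlet energy of
  the corresponding eigenfunction, so the zeros are simple and there is only one per interval.

  The modes \<open>J\<^sub>k(\<alpha> r) e\<^sup>\<plusminus>\<^sup>i\<^sup>k\<^sup>\<theta>\<close> and \<open>I\<^sub>k(\<beta> r) e\<^sup>\<plusminus>\<^sup>i\<^sup>k\<^sup>\<theta>\<close> are multiples of \<open>\<zeta>\<^sup>k \<phi>(|x|\<^sup>2)\<close> with
  \<open>\<zeta> = x\<^sub>1 \<plusminus> i x\<^sub>2\<close> and \<open>\<phi>\<close> entire, hence smooth on the whole plane, and they are eigenfunctions of the
  Laplacian with eigenvalues \<open>-\<alpha>\<^sup>2\<close> and \<open>\<beta>\<^sup>2\<close>.\<close>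

section \<open>Bessel functions\<close>

text \<open>The Bessel-Clifford function, an entire function. \<open>J\<^sub>k(x)\<close> is
  \<open>(x/2)\<^sup>k\<close> times its value at \<open>-x\<^sup>2/4\<close>, and
  \<open>I\<^sub>k(x)\<close> uses \<open>x\<^sup>2/4\<close> instead, so one series serves both and
  stays smooth when \<open>x\<^sup>2\<close> becomes \<open>|x|\<^sup>2\<close> on the
  plane.\<close>

definition clifford :: "nat \<Rightarrow> real \<Rightarrow> real" where
  "clifford k t = (\<Sum>m. 1 / (fact m * fact (m + k)) * t ^ m)"

lemma summable_clifford: "summable (\<lambda>m. 1 / (fact m * fact (m + k)) * t ^ m :: real)"
proof (rule summable_comparison_test')
  show "summable (\<lambda>m. \<bar>t\<bar> ^ m / fact m)"
    using summable_exp[of "\<bar>t\<bar>"] by (simp add: field_simps)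
  fix m :: nat
  have "(1::real) \<le> fact (m + k)" by (rule fact_ge_1)
  hence "\<bar>t\<bar> ^ m / (fact m * fact (m + k)) \<le> \<bar>t\<bar> ^ m / fact m"
    by (intro divide_left_mono) auto
  thus "norm (1 / (fact m * fact (m + k)) * t ^ m :: real) \<le> \<bar>t\<bar> ^ m / fact m"
    by (simp add: abs_mult power_abs)
qed

lemma clifford_sums: "(\<lambda>m. 1 / (fact m * fact (m + k)) * t ^ m) sums clifford k t"
  unfolding clifford_def using summable_clifford by (rule summable_sums)

text \<open>Termwise differentiation raises the index by one, because the factor
  \<open>m + 1\<close> cancels against \<open>(m + 1)!\<close>.\<close>

lemma diffs_clifford:
  "diffs (\<lambda>m. 1 / (fact m * fact (m + k)) :: real) = (\<lambda>m. 1 / (fact m * fact (m + Suc k)))"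
proof
  fix m :: nat
  have "(fact (Suc m) :: real) = of_nat (Suc m) * fact m" by (rule fact_Suc)
  thus "diffs (\<lambda>m. 1 / (fact m * fact (m + k)) :: real) m = 1 / (fact m * fact (m + Suc k))"
    unfolding diffs_def by (simp del: fact_Suc of_nat_Suc)
qed

lemma DERIV_clifford: "(clifford k has_real_derivative clifford (Suc k) t) (at t)"
  using termdiffs_strong_converges_everywhere[OF summable_clifford, of k t]
  unfolding diffs_clifford clifford_def[abs_def] .

text \<open>The coefficients of \<open>t\<^sup>m\<close> agree because \<open>(k + 1) + m\<close> is
  the quotient of \<open>(m + k + 1)!\<close> by \<open>(m + k)!\<close>. This is the common source
  of both three-term Bessel recurrences.\<close>

lemma clifford_rec: "clifford k t = real (Suc k) * clifford (Suc k) t + t * clifford (Suc (Suc k)) t"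
proof -
  let ?c = "\<lambda>k m. 1 / (fact m * fact (m + k)) :: real"
  \<comment> \<open>The series of \<open>t * clifford (Suc (Suc k)) t\<close> with its index shifted
    by one, hence with constant term zero.\<close>
  define h where "h m = (if m = 0 then 0 else ?c (Suc (Suc k)) (m - 1) * t ^ m)" for m
  have "(\<lambda>m. t * (?c (Suc (Suc k)) m * t ^ m)) sums (t * clifford (Suc (Suc k)) t)"
    by (intro sums_mult clifford_sums)
  hence "(\<lambda>m. h (Suc m)) sums (t * clifford (Suc (Suc k)) t)"
    by (simp add: h_def mult_ac del: fact_Suc)
  hence "h sums (t * clifford (Suc (Suc k)) t)"
    using sums_Suc_iff[of h] by (simp add: h_def)
  hence "(\<lambda>m. real (Suc k) * (?c (Suc k) m * t ^ m) + h m) sums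
      (real (Suc k) * clifford (Suc k) t + t * clifford (Suc (Suc k)) t)"
    by (intro sums_add sums_mult clifford_sums)
  moreover have "real (Suc k) * (?c (Suc k) m * t ^ m) + h m = ?c k m * t ^ m" for m
  proof (cases m)
    case 0
    have "(fact (Suc k)::real) = real (Suc k) * fact k" by (rule fact_Suc)
    with 0 show ?thesis by (simp add: h_def del: fact_Suc of_nat_Suc)
  next
    case (Suc n)
    define N :: real where "N = fact n"
    define M :: real where "M = fact (n + Suc k)"
    have f: "(fact (Suc n)::real) = (real n + 1) * N"
      "(fact (n + Suc (Suc k))::real) = (real n + real k + 2) * M"
      "(fact (Suc n + Suc k)::real) = (real n + real k + 2) * M"
      "(fact (Suc n + k)::real) = M"
      by (simp_all add: N_def M_def algebra_simps)
    have p: "N > 0" "M > 0" by (simp_all add: N_def M_def)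
    have "real n + 1 \<noteq> 0" "real n + real k + 2 \<noteq> 0" by linarith+
    hence "real (Suc k) * (1 / (((real n + 1) * N) * ((real n + real k + 2) * M)) * t ^ m)
        + 1 / (N * ((real n + real k + 2) * M)) * t ^ m
        = 1 / (((real n + 1) * N) * M) * t ^ m"
      using p by (simp add: divide_simps del: of_nat_Suc) (simp add: algebra_simps)
    moreover have "h (Suc n) = 1 / (N * fact (n + Suc (Suc k))) * t ^ Suc n"
      by (simp add: h_def N_def del: fact_Suc)
    ultimately show ?thesis by (simp only: Suc f)
  qed
  ultimately have "(\<lambda>m. ?c k m * t ^ m) sums
      (real (Suc k) * clifford (Suc k) t + t * clifford (Suc (Suc k)) t)" by simp
  thus ?thesis using clifford_sums[of k t] by (rule sums_unique2[symmetric])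
qed

lemma clifford_pos: assumes "t \<ge> 0" shows "clifford k t > 0"
proof -
  have "1 / (fact 0 * fact (0 + k)) * t ^ 0 \<le> clifford k t"
    unfolding clifford_def using assms
    using sum_le_suminf[OF summable_clifford, of "{0}" k t] by simp
  moreover have "1 / (fact 0 * fact (0 + k)) * t ^ 0 > (0::real)" by simp
  ultimately show ?thesis by linarith
qed

lemma bessel_J_eq: "bessel_J k x = (x / 2) ^ k * clifford k (- (x / 2)\<^sup>2)"
proof -
  have "(\<lambda>m. (x / 2) ^ k * (1 / (fact m * fact (m + k)) * (- (x / 2)\<^sup>2) ^ m)) sums
     ((x / 2) ^ k * clifford k (- (x / 2)\<^sup>2))"
    by (intro sums_mult clifford_sums)
  moreover have "(x / 2) ^ k * (1 / (fact m * fact (m + k)) * (- (x / 2)\<^sup>2) ^ m)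
      = (-1) ^ m / (fact m * fact (m + k)) * (x / 2) ^ (2 * m + k)" for m
    by (subst power_minus) (simp add: power_add power_mult)
  ultimately show ?thesis unfolding bessel_J_def by (simp add: sums_iff)
qed

lemma bessel_I_eq: "bessel_I k x = (x / 2) ^ k * clifford k ((x / 2)\<^sup>2)"
proof -
  have "(\<lambda>m. (x / 2) ^ k * (1 / (fact m * fact (m + k)) * ((x / 2)\<^sup>2) ^ m)) sums
     ((x / 2) ^ k * clifford k ((x / 2)\<^sup>2))"
    by (intro sums_mult clifford_sums)
  moreover have "(x / 2) ^ k * (1 / (fact m * fact (m + k)) * ((x / 2)\<^sup>2) ^ m)
      = 1 / (fact m * fact (m + k)) * (x / 2) ^ (2 * m + k)" for m
    by (simp add: power_add power_mult)
  ultimately show ?thesis unfolding bessel_I_def by (simp add: sums_iff)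
qed

lemma continuous_on_clifford [continuous_intros]:
  "continuous_on S f \<Longrightarrow> continuous_on S (\<lambda>x. clifford k (f x))"
  using continuous_on_compose2[of UNIV "clifford k" S f]
    DERIV_isCont[OF DERIV_clifford] continuous_at_imp_continuous_on by blast

lemma continuous_on_bessel_J [continuous_intros]:
  "continuous_on S f \<Longrightarrow> continuous_on S (\<lambda>x. bessel_J k (f x))"
  unfolding bessel_J_eq by (intro continuous_intros) auto

lemma continuous_on_bessel_I [continuous_intros]:
  "continuous_on S f \<Longrightarrow> continuous_on S (\<lambda>x. bessel_I k (f x))"
  unfolding bessel_I_eq by (intro continuous_intros) auto

lemma DERIV_clifford_chain [derivative_intros]:
  "(f has_real_derivative D) (at x within S) \<Longrightarrow>
    ((\<lambda>x. clifford k (f x)) has_real_derivative clifford (Suc k) (f x) * D) (at x within S)"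
  using DERIV_chain'[OF _ DERIV_clifford[of k]] by (simp add: mult.commute)

section \<open>Derivatives and recurrences of the Bessel functions\<close>

lemma DERIV_bessel_J:
  assumes "x \<noteq> 0"
  shows "(bessel_J k has_real_derivative (real k / x * bessel_J k x - bessel_J (Suc k) x)) (at x)"
  unfolding bessel_J_eq[abs_def]
  by (rule derivative_eq_intros refl | simp)+
     (use assms in \<open>cases k; simp add: field_simps power2_eq_square\<close>)

lemma DERIV_bessel_I:
  assumes "x \<noteq> 0"
  shows "(bessel_I k has_real_derivative (real k / x * bessel_I k x + bessel_I (Suc k) x)) (at x)"
  unfolding bessel_I_eq[abs_def]
  by (rule derivative_eq_intros refl | simp)+
     (use assms in \<open>cases k; simp add: field_simps power2_eq_square\<close>)

lemma bessel_J_rec: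
  "x * bessel_J k x + x * bessel_J (Suc (Suc k)) x = 2 * real (Suc k) * bessel_J (Suc k) x"
proof -
  have "x * bessel_J k x = x * (x / 2) ^ k * (real (Suc k) * clifford (Suc k) (- (x / 2)\<^sup>2)
     + (- (x / 2)\<^sup>2) * clifford (Suc (Suc k)) (- (x / 2)\<^sup>2))"
    by (subst clifford_rec[symmetric]) (simp add: bessel_J_eq)
  thus ?thesis by (simp add: bessel_J_eq field_simps power2_eq_square)
qed

lemma bessel_I_rec:
  "x * bessel_I k x - x * bessel_I (Suc (Suc k)) x = 2 * real (Suc k) * bessel_I (Suc k) x"
proof -
  have "x * bessel_I k x = x * (x / 2) ^ k * (real (Suc k) * clifford (Suc k) ((x / 2)\<^sup>2)
     + ((x / 2)\<^sup>2) * clifford (Suc (Suc k)) ((x / 2)\<^sup>2))"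
    by (subst clifford_rec[symmetric]) (simp add: bessel_I_eq)
  thus ?thesis by (simp add: bessel_I_eq field_simps power2_eq_square)
qed

text \<open>The recurrence eliminates the index \<open>k + 2\<close>, so that
  \<open>bessel_J k\<close> and \<open>bessel_J (Suc k)\<close> satisfy a closed first-order linear
  system.\<close>

lemma DERIV_bessel_J_Suc:
  assumes "x \<noteq> 0"
  shows "(bessel_J (Suc k) has_real_derivative (bessel_J k x - real (Suc k) / x * bessel_J (Suc k) x)) (at x)"
proof -
  have "real (Suc k) / x * bessel_J (Suc k) x - bessel_J (Suc (Suc k)) x
      = bessel_J k x - real (Suc k) / x * bessel_J (Suc k) x"
    using bessel_J_rec[of x k] assms by (simp add: field_simps)
  thus ?thesis using DERIV_bessel_J[OF assms, of "Suc k"] by (simp only:)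
qed

lemma DERIV_bessel_I_Suc:
  assumes "x \<noteq> 0"
  shows "(bessel_I (Suc k) has_real_derivative (bessel_I k x - real (Suc k) / x * bessel_I (Suc k) x)) (at x)"
proof -
  have "real (Suc k) / x * bessel_I (Suc k) x + bessel_I (Suc (Suc k)) x
      = bessel_I k x - real (Suc k) / x * bessel_I (Suc k) x"
    using bessel_I_rec[of x k] assms by (simp add: field_simps)
  thus ?thesis using DERIV_bessel_I[OF assms, of "Suc k"] by (simp only:)
qed

lemma bessel_I_pos: "x > 0 \<Longrightarrow> bessel_I k x > 0"
  unfolding bessel_I_eq by (intro mult_pos_pos clifford_pos) auto

text \<open>\<open>J\<^sub>k\<close> is \<open>(x/2)\<^sup>k\<close> times a continuous function
  that is positive at 0. This supplies the initial sign and keeps the positive zeros away from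
  0.\<close>

lemma bessel_J_pos_near_0: "\<exists>d>0. \<forall>x. 0 < x \<and> x < d \<longrightarrow> bessel_J k x > 0"
proof -
  have "isCont (\<lambda>x. clifford k (- (x / 2)\<^sup>2)) 0"
    by (intro continuous_on_interior[of UNIV] continuous_intros) auto
  moreover have "clifford k (- (0 / 2)\<^sup>2) > 0" by (simp add: clifford_pos)
  ultimately have "\<forall>\<^sub>F x in at 0. clifford k (- (x / 2)\<^sup>2) > 0"
    unfolding isCont_def by (rule order_tendstoD)
  then obtain d where "d > 0" "\<And>x. x \<noteq> 0 \<Longrightarrow> dist x 0 < d \<Longrightarrow> clifford k (- (x / 2)\<^sup>2) > 0"
    unfolding eventually_at by auto
  thus ?thesis by (intro exI[of _ d]) (auto simp: bessel_J_eq)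
qed

section \<open>Enumerating zeros\<close>

lemma eventually_neq_of_DERIV_nonzero:
  fixes f :: "real \<Rightarrow> real"
  assumes "(f has_real_derivative D) (at x)" "D \<noteq> 0"
  shows "\<forall>\<^sub>F y in at x. f y \<noteq> f x"
proof -
  have "((\<lambda>y. (f y - f x) / (y - x)) \<longlongrightarrow> D) (at x)"
    using assms(1) by (simp add: has_field_derivative_iff)
  from tendsto_imp_eventually_ne[OF this assms(2)] show ?thesis
    by (rule eventually_mono) auto
qed

text \<open>By compactness, infinitely many zeros would accumulate at a zero, but a zero with
  nonzero derivative is isolated.\<close>

lemma finite_simple_zeros:
  fixes f :: "real \<Rightarrow> real"
  assumes "compact S" "continuous_on S f"
    and "\<And>x. x \<in> S \<Longrightarrow> f x = 0 \<Longrightarrow> \<exists>D. (f has_real_derivative D) (at x) \<and> D \<noteq> 0"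
  shows "finite {x \<in> S. f x = 0}"
proof (rule ccontr)
  assume "infinite {x \<in> S. f x = 0}"
  moreover have "compact {x \<in> S. f x = 0}"
  proof -
    have "closed {x \<in> S. f x = 0}"
      using continuous_closed_preimage_constant[OF assms(2)] assms(1) compact_imp_closed by blast
    moreover have "{x \<in> S. f x = 0} = S \<inter> {x \<in> S. f x = 0}" by auto
    ultimately show ?thesis using assms(1) compact_Int_closed by metis
  qed
  ultimately obtain x where x: "x \<in> S" "f x = 0" "x islimpt {x \<in> S. f x = 0}"
    unfolding compact_eq_Bolzano_Weierstrass by blast
  from assms(3)[OF x(1,2)] obtain D where "(f has_real_derivative D) (at x)" "D \<noteq> 0" by blast
  hence "\<forall>\<^sub>F y in at x. f y \<noteq> 0" using eventually_neq_of_DERIV_nonzero[of f D x] x(2) by simp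
  moreover have "\<exists>\<^sub>F y in at x. y \<in> {x \<in> S. f x = 0}"
    using x(3) islimpt_iff_eventually frequently_def by fastforce
  ultimately have "\<exists>\<^sub>F y in at x. y \<in> {x \<in> S. f x = 0} \<and> f y \<noteq> 0"
    by (intro frequently_eventually_frequently)
  thus False by simp
qed

lemma same_sign_on_interval:
  fixes f :: "real \<Rightarrow> real"
  assumes "a \<le> b" "continuous_on {a..b} f" "\<And>x. a \<le> x \<Longrightarrow> x \<le> b \<Longrightarrow> f x \<noteq> 0"
  shows "f a * f b > 0"
proof (rule ccontr)
  assume "\<not> f a * f b > 0"
  hence "(f a \<le> 0 \<and> 0 \<le> f b) \<or> (f b \<le> 0 \<and> 0 \<le> f a)"
    by (auto simp: not_less mult_le_0_iff)
  thus False
    using IVT'[of f a 0 b] IVT2'[of f b 0 a] assms by blast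
qed

text \<open>\<open>f\<close> is positive just right of \<open>a\<close>. At the first zero after
  that it increases, so it is negative just before, and the intermediate value theorem yields a
  still earlier zero.\<close>

lemma zeros_with_positive_derivative_unique:
  fixes f :: "real \<Rightarrow> real"
  assumes "a < b" "f a = 0" "f b = 0" "continuous_on {a..b} f"
    and d: "\<And>x. a \<le> x \<Longrightarrow> x \<le> b \<Longrightarrow> f x = 0 \<Longrightarrow> \<exists>D>0. (f has_real_derivative D) (at x)"
  shows False
proof -
  obtain D where D: "D > 0" "(f has_real_derivative D) (at a)"
    using d[OF order_refl less_imp_le[OF assms(1)] assms(2)] by blast
  from DERIV_pos_inc_right[OF D(2,1)] obtain e where
    e: "e > 0" "\<And>h. h > 0 \<Longrightarrow> h < e \<Longrightarrow> f a < f (a + h)" by blast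
  \<comment> \<open>Starting the search at a point with \<open>f c > 0\<close> excludes the zero
    \<open>a\<close> while keeping the set of later zeros compact.\<close>
  define c where "c = a + min e (b - a) / 2"
  have c: "a < c" "c < b" "f c > 0"
    using e(1) e(2)[of "min e (b - a) / 2"] assms(1,2) by (auto simp: c_def min_def field_simps)
  have "{x \<in> {c..b}. f x = 0} = {c..b} \<inter> {x \<in> {a..b}. f x = 0}" using c by auto
  moreover have "closed {x \<in> {a..b}. f x = 0}"
    using continuous_closed_preimage_constant[OF assms(4)] by simp
  ultimately have "compact {x \<in> {c..b}. f x = 0}"
    by (simp add: compact_Int_closed)
  moreover have "b \<in> {x \<in> {c..b}. f x = 0}" using c assms by auto
  ultimately obtain z where z: "c \<le> z" "z \<le> b" "f z = 0"
    "\<And>x. c \<le> x \<Longrightarrow> x \<le> b \<Longrightarrow> f x = 0 \<Longrightarrow> z \<le> x"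
    using compact_attains_inf[of "{x \<in> {c..b}. f x = 0}"] by auto
  have "c < z" using z c by (cases "c = z") auto
  obtain D' where D': "D' > 0" "(f has_real_derivative D') (at z)"
    using d[of z] z c by (meson less_imp_le order_trans)
  from DERIV_pos_inc_left[OF D'(2,1)] obtain e' where
    e': "e' > 0" "\<And>h. h > 0 \<Longrightarrow> h < e' \<Longrightarrow> f (z - h) < f z" by blast
  define w where "w = z - min e' (z - c) / 2"
  have w: "c < w" "w < z" "f w < 0"
    using e'(1) e'(2)[of "min e' (z - c) / 2"] \<open>c < z\<close> z(3) by (auto simp: w_def min_def field_simps)
  have "continuous_on {c..w} f"
    using assms(4) by (rule continuous_on_subset) (use w z c in auto)
  hence "\<exists>x\<ge>c. x \<le> w \<and> f x = 0"
    using IVT2'[of f w 0 c] w c by auto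
  thus False using z w by force
qed

section \<open>Increasing enumerations of discrete sets of reals\<close>

lemma card_strict_mono_enumeration:
  fixes z :: "nat \<Rightarrow> real"
  assumes "strict_mono_on {1..} z" "l \<ge> 1"
  shows "card {y \<in> z ` {1..}. y \<le> z l} = l"
proof -
  have le: "z m \<le> z l \<longleftrightarrow> m \<le> l" if "m \<ge> 1" for m
    using strict_mono_onD[OF assms(1), of l m] strict_mono_onD[OF assms(1), of m l] that assms(2)
    by (cases m l rule: linorder_cases) auto
  have "{y \<in> z ` {1..}. y \<le> z l} = z ` {1..l}" using le by auto
  moreover have "inj_on z {1..l}"
    using strict_mono_on_imp_inj_on[OF assms(1)] by (rule inj_on_subset) auto
  ultimately show ?thesis by (simp add: card_image)
qed

text \<open>The rank \<open>c x\<close>, the number of elements up to \<open>x\<close>, is an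
  increasing bijection from \<open>Z\<close> onto the positive integers. Its inverse is the
  enumeration.\<close>

lemma ex_strict_mono_enumeration:
  fixes Z :: "real set"
  assumes "infinite Z" and fin: "\<And>M. finite {y \<in> Z. y \<le> M}"
  shows "\<exists>z :: nat \<Rightarrow> real. strict_mono_on {1..} z \<and> z ` {1..} = Z"
proof -
  define c where "c x = card {y \<in> Z. y \<le> x}" for x
  have less: "c x < c y" if "x \<in> Z" "y \<in> Z" "x < y" for x y
    unfolding c_def by (rule psubset_card_mono[OF fin]) (use that in force)
  have inj: "inj_on c Z"
    by (rule inj_onI) (metis less less_irrefl linorder_less_linear)
  have pos: "c x \<ge> 1" if "x \<in> Z" for x
    unfolding c_def using that fin by (simp add: Suc_le_eq card_gt_0_iff) auto
  \<comment> \<open>An initial segment of \<open>c x\<close> elements is mapped injectively into a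
    set of \<open>c x\<close> numbers, so no rank is skipped.\<close>
  have seg: "c ` {y \<in> Z. y \<le> x} = {1..c x}" if "x \<in> Z" for x
  proof (rule card_subset_eq)
    show "c ` {y \<in> Z. y \<le> x} \<subseteq> {1..c x}"
      using pos less[OF _ that] by (force simp: le_less)
    have "inj_on c {y \<in> Z. y \<le> x}" using inj by (rule inj_on_subset) auto
    hence "card (c ` {y \<in> Z. y \<le> x}) = c x" unfolding c_def[of x] by (rule card_image)
    thus "card (c ` {y \<in> Z. y \<le> x}) = card {1..c x}" by simp
  qed auto
  have "c ` Z = {1..}"
  proof
    show "c ` Z \<subseteq> {1..}" using pos by auto
    show "{1..} \<subseteq> c ` Z"
    proof
      fix n :: nat assume n: "n \<in> {1..}"
      have "infinite (c ` Z)" using assms(1) inj finite_imageD by blast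
      then obtain x where x: "x \<in> Z" "n \<le> c x"
        unfolding infinite_nat_iff_unbounded_le by blast
      hence "n \<in> c ` {y \<in> Z. y \<le> x}" using seg n by auto
      thus "n \<in> c ` Z" by auto
    qed
  qed
  hence bij: "bij_betw c Z {1..}" using inj by (simp add: bij_betw_def)
  let ?z = "inv_into Z c"
  have im: "?z ` {1..} = Z" using bij_betw_inv_into[OF bij] by (simp add: bij_betw_def)
  have cz: "c (?z l) = l" if "l \<in> {1..}" for l using bij_betw_inv_into_right[OF bij that] .
  have "strict_mono_on {1..} ?z"
  proof (rule strict_mono_onI)
    fix l m :: nat assume lm: "l \<in> {1..}" "m \<in> {1..}" "l < m"
    hence "?z l \<in> Z" "?z m \<in> Z" using im by auto
    thus "?z l < ?z m" using less[of "?z m" "?z l"] cz lm by (metis linorder_neqE order.asym)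
  qed
  with im show ?thesis by blast
qed

lemma strict_mono_enumeration_locate:
  fixes z :: "nat \<Rightarrow> real"
  assumes z: "strict_mono_on {1..} z" and fin: "finite {y \<in> z ` {1..}. y \<le> x}" and "z 1 \<le> x"
  obtains l where "l \<ge> 1" "z l \<le> x" "x < z (Suc l)"
proof -
  have "{l. l \<ge> 1 \<and> z l \<le> x} \<subseteq> {1..}" by auto
  hence "inj_on z {l. l \<ge> 1 \<and> z l \<le> x}"
    using strict_mono_on_imp_inj_on[OF z] inj_on_subset by blast
  moreover have "finite (z ` {l. l \<ge> 1 \<and> z l \<le> x})"
    using fin by (rule finite_subset[rotated]) auto
  ultimately have f: "finite {l. l \<ge> 1 \<and> z l \<le> x}" by (rule finite_imageD[rotated])
  have ne: "{l. l \<ge> 1 \<and> z l \<le> x} \<noteq> {}" using assms(3) by auto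
  let ?l = "Max {l. l \<ge> 1 \<and> z l \<le> x}"
  have "?l \<ge> 1" "z ?l \<le> x" using Max_in[OF f ne] by auto
  moreover have "x < z (Suc ?l)"
    using Max_ge[OF f, of "Suc ?l"] by force
  ultimately show ?thesis by (rule that)
qed

lemma strict_mono_enumeration_gap:
  fixes z :: "nat \<Rightarrow> real"
  assumes "strict_mono_on {1..} z" "l \<ge> 1" "z l < x" "x < z (Suc l)"
  shows "x \<notin> z ` {1..}"
proof
  assume "x \<in> z ` {1..}"
  then obtain m where m: "m \<ge> 1" "x = z m" by auto
  show False
  proof (cases "m \<le> l")
    case True
    hence "z m \<le> z l" using strict_mono_onD[OF assms(1), of m l] m assms(2) by (cases "m = l") auto
    thus False using m assms by auto
  next
    case False
    hence "z (Suc l) \<le> z m" using strict_mono_onD[OF assms(1), of "Suc l" m] m assms(2)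
      by (cases "m = Suc l") auto
    thus False using m assms by auto
  qed
qed

text \<open>Values of \<open>y\<close> at different indices are separated by a value of
  \<open>z\<close>. This serves both for the roots of \<open>bessel_J (Suc k)\<close> and for the
  zeros of \<open>F_fun\<close>.\<close>

lemma strict_mono_enumeration_interval_choice:
  fixes z y :: "nat \<Rightarrow> real"
  assumes "strict_mono_on {1..} z" "\<And>l. l \<ge> 1 \<Longrightarrow> z l < y l \<and> y l < z (Suc l)"
  shows "strict_mono_on {1..} y"
proof (rule strict_mono_onI)
  fix l m :: nat assume lm: "l \<in> {1..}" "m \<in> {1..}" "l < m"
  have "z (Suc l) \<le> z m" using strict_mono_onD[OF assms(1), of "Suc l" m] lm
    by (cases "m = Suc l") auto
  thus "y l < y m" using assms(2)[of l] assms(2)[of m] lm by auto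
qed

section \<open>Zeros of Bessel functions\<close>

definition J_zeros :: "nat \<Rightarrow> real set" where
  "J_zeros k = {x. x > 0 \<and> bessel_J k x = 0}"

text \<open>For \<open>x > 0\<close> this is \<open>(x J\<^sub>k'(x))\<^sup>2 + (x\<^sup>2 -
  k\<^sup>2) J\<^sub>k(x)\<^sup>2\<close>, which is twice the integral of
  \<open>t J\<^sub>k(t)\<^sup>2\<close> over \<open>[0, x]\<close> (Lommel's integral).\<close>

definition J_energy :: "nat \<Rightarrow> real \<Rightarrow> real" where
  "J_energy k x = (x * bessel_J (Suc k) x)\<^sup>2
     - 2 * real k * (x * bessel_J k x * bessel_J (Suc k) x) + (x * bessel_J k x)\<^sup>2"

lemma DERIV_x_bessel_J:
  assumes "x > 0"
  shows "((\<lambda>x. x * bessel_J k x) has_real_derivative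
    (real k + 1) * bessel_J k x - x * bessel_J (Suc k) x) (at x)"
  by (rule DERIV_cong[OF DERIV_mult'[OF DERIV_ident DERIV_bessel_J]])
     (use assms in \<open>simp_all add: right_diff_distrib distrib_right\<close>)

lemma DERIV_x_bessel_J_Suc:
  assumes "x > 0"
  shows "((\<lambda>x. x * bessel_J (Suc k) x) has_real_derivative
    x * bessel_J k x - real k * bessel_J (Suc k) x) (at x)"
  by (rule DERIV_cong[OF DERIV_mult'[OF DERIV_ident DERIV_bessel_J_Suc]])
     (use assms in \<open>simp_all add: right_diff_distrib distrib_right\<close>)

lemma DERIV_x_bessel_J_mult_Suc:
  assumes "x > 0"
  shows "((\<lambda>x. x * bessel_J k x * bessel_J (Suc k) x) has_real_derivative
    x * (bessel_J k x)\<^sup>2 - x * (bessel_J (Suc k) x)\<^sup>2) (at x)"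
  by (rule DERIV_cong[OF DERIV_mult'[OF DERIV_x_bessel_J DERIV_bessel_J_Suc]])
     (use assms in \<open>simp_all add: algebra_simps add_divide_distrib power2_eq_square\<close>)

lemma DERIV_J_energy:
  assumes "x > 0"
  shows "(J_energy k has_real_derivative 2 * x * (bessel_J k x)\<^sup>2) (at x)"
  unfolding J_energy_def[abs_def]
  by (rule DERIV_cong[OF DERIV_add[OF DERIV_diff[OF DERIV_power[OF DERIV_x_bessel_J_Suc]
       DERIV_cmult[OF DERIV_x_bessel_J_mult_Suc]] DERIV_power[OF DERIV_x_bessel_J]]])
     (use assms in \<open>simp_all add: algebra_simps power2_eq_square\<close>)

text \<open>The energy starts at 0 and its derivative is nonnegative. Strict growth comes from an
  initial interval without zeros of \<open>J\<^sub>k\<close>; beyond it monotonicity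
  suffices.\<close>

lemma J_energy_pos:
  assumes "x > 0"
  shows "J_energy k x > 0"
proof -
  obtain d where d: "d > 0" "\<And>y. 0 < y \<Longrightarrow> y < d \<Longrightarrow> bessel_J k y > 0"
    using bessel_J_pos_near_0[of k] by blast
  define e where "e = min x (d / 2)"
  have e: "0 < e" "e \<le> x" "e < d" using assms d(1) by (auto simp: e_def)
  have cont: "continuous_on S (J_energy k)" for S
    unfolding J_energy_def[abs_def] by (intro continuous_intros)
  have "J_energy k 0 < J_energy k e"
  proof (rule DERIV_pos_imp_increasing_open[OF e(1)])
    fix y assume "0 < y" "y < e"
    thus "\<exists>D. (J_energy k has_real_derivative D) (at y) \<and> 0 < D"
      using DERIV_J_energy[of y k] d(2)[of y] e by (auto intro!: exI[of _ "2 * y * (bessel_J k y)\<^sup>2"])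
  qed (rule cont)
  moreover have "J_energy k 0 = 0" by (simp add: J_energy_def)
  moreover have "J_energy k e \<le> J_energy k x"
  proof (rule DERIV_nonneg_imp_nondecreasing[OF e(2)])
    fix y assume "e \<le> y" "y \<le> x"
    thus "\<exists>D. (J_energy k has_real_derivative D) (at y) \<and> 0 \<le> D"
      using DERIV_J_energy[of y k] e by (auto intro!: exI[of _ "2 * y * (bessel_J k y)\<^sup>2"])
  qed
  ultimately show ?thesis by linarith
qed

text \<open>At a zero of \<open>J\<^sub>k\<close> the positive energy reduces to the square of
  \<open>x * bessel_J (Suc k) x\<close>. In particular the positive zeros of
  \<open>J\<^sub>k\<close> are simple.\<close>

lemma no_common_zero:
  assumes "x > 0" "bessel_J k x = 0" shows "bessel_J (Suc k) x \<noteq> 0"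
  using J_energy_pos[OF assms(1), of k] assms(2) by (auto simp: J_energy_def)

text \<open>Where defined, this is \<open>k - x J\<^sub>k' / J\<^sub>k\<close>, a logarithmic
  derivative up to sign and shift. Its growth between zeros of \<open>J\<^sub>k\<close> drives the
  arguments that locate zeros.\<close>

definition J_ratio :: "nat \<Rightarrow> real \<Rightarrow> real" where
  "J_ratio k x = x * bessel_J (Suc k) x / bessel_J k x"

lemma DERIV_J_ratio:
  assumes "x > 0" "bessel_J k x \<noteq> 0"
  shows "(J_ratio k has_real_derivative J_energy k x / (x * (bessel_J k x)\<^sup>2)) (at x)"
proof -
  have algebra: "((x * a - c * b) * a - x * b * (c / x * a - b)) / (a * a)
      = ((x * b)\<^sup>2 - 2 * c * (x * a * b) + (x * a)\<^sup>2) / (x * a\<^sup>2)" for a b c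
  proof -
    have "x * b * (c / x * a - b) = b * c * a - x * b * b"
      using assms(1) by (simp add: right_diff_distrib)
    hence "(x * a - c * b) * a - x * b * (c / x * a - b) = x * a * a - 2 * c * a * b + x * b * b"
      by (simp add: algebra_simps)
    moreover have "(x * b)\<^sup>2 - 2 * c * (x * a * b) + (x * a)\<^sup>2
        = x * (x * a * a - 2 * c * a * b + x * b * b)"
      by (simp add: algebra_simps power2_eq_square)
    ultimately show ?thesis using assms(1) by (simp add: power2_eq_square)
  qed
  have "x \<noteq> 0" using assms by simp
  from DERIV_divide[OF DERIV_x_bessel_J_Suc[OF assms(1), of k] DERIV_bessel_J[OF this] assms(2)]
  show ?thesis
    unfolding J_ratio_def[abs_def] J_energy_def algebra .
qed

lemma J_ratio_strict_mono:
  assumes "0 < x" "x < y" "\<And>t. x \<le> t \<Longrightarrow> t \<le> y \<Longrightarrow> bessel_J k t \<noteq> 0"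
  shows "J_ratio k x < J_ratio k y"
proof (rule DERIV_pos_imp_increasing[OF assms(2)])
  fix t assume "x \<le> t" "t \<le> y"
  thus "\<exists>D. (J_ratio k has_real_derivative D) (at t) \<and> 0 < D"
    using DERIV_J_ratio[of t k] assms J_energy_pos[of t k]
    by (auto intro!: exI[of _ "J_energy k t / (t * (bessel_J k t)\<^sup>2)"])
qed

text \<open>A Riccati argument. Without zeros beyond \<open>M\<close>, the function
  \<open>S = - x J\<^sub>k' / J\<^sub>k\<close> satisfies
  \<open>x S' = S\<^sup>2 + x\<^sup>2 - k\<^sup>2\<close> on a half-line. The term
  \<open>x\<^sup>2 - k\<^sup>2\<close> eventually makes \<open>S\<close> positive; then
  \<open>ln x + 1 / S\<close> is nonincreasing, although \<open>ln x\<close> is unbounded.\<close>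

lemma ex_J_zero_greater: "\<exists>x>M. bessel_J k x = 0"
proof (rule ccontr)
  assume no: "\<not> ?thesis"
  \<comment> \<open>From \<open>k + 1\<close> on, \<open>x\<^sup>2 - k\<^sup>2 \<ge> x\<close>,
    hence \<open>S' \<ge> 1\<close>.\<close>
  define a where "a = max M (real k) + 1"
  have a: "a > M" "a \<ge> real k + 1" by (auto simp: a_def)
  have nz: "bessel_J k x \<noteq> 0" if "x \<ge> a" for x using no that a by force
  define S where "S x = J_ratio k x - real k" for x
  have D: "(S has_real_derivative ((S x)\<^sup>2 + (x\<^sup>2 - (real k)\<^sup>2)) / x) (at x)" if "x \<ge> a" for x
  proof -
    have "x > 0" using that a by auto
    have "(S has_real_derivative J_energy k x / (x * (bessel_J k x)\<^sup>2)) (at x)"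
      unfolding S_def[abs_def]
      by (rule derivative_eq_intros DERIV_J_ratio \<open>x > 0\<close> nz[OF that] refl | simp)+
    moreover have "J_energy k x / (x * (bessel_J k x)\<^sup>2) = ((S x)\<^sup>2 + (x\<^sup>2 - (real k)\<^sup>2)) / x"
    proof -
      define r where "r = J_ratio k x"
      have "x * bessel_J (Suc k) x = r * bessel_J k x"
        unfolding r_def J_ratio_def using nz[OF that] by simp
      hence "J_energy k x = (r * bessel_J k x)\<^sup>2 - 2 * real k * (bessel_J k x * (r * bessel_J k x))
          + (x * bessel_J k x)\<^sup>2"
        unfolding J_energy_def by (simp add: mult_ac)
      also have "\<dots> = ((S x)\<^sup>2 + (x\<^sup>2 - (real k)\<^sup>2)) * (bessel_J k x)\<^sup>2"
        unfolding S_def r_def[symmetric] by (simp add: algebra_simps power2_eq_square)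
      finally show ?thesis using nz[OF that] by simp
    qed
    ultimately show ?thesis by simp
  qed
  have sq: "x\<^sup>2 - (real k)\<^sup>2 \<ge> x" if "x \<ge> a" for x
  proof -
    have "1 * (x + real k) \<le> (x - real k) * (x + real k)"
      using that a by (intro mult_right_mono) auto
    thus ?thesis by (simp add: power2_eq_square algebra_simps)
  qed
  have grow: "S a - a \<le> S x - x" if "x \<ge> a" for x
  proof (rule DERIV_nonneg_imp_nondecreasing[OF that])
    fix t assume t: "a \<le> t" "t \<le> x"
    have "((S t)\<^sup>2 + (t\<^sup>2 - (real k)\<^sup>2)) / t - 1 \<ge> 0"
      using sq[OF t(1)] t a by (simp add: field_simps add_increasing2)
    moreover have "((\<lambda>t. S t - t) has_real_derivative ((S t)\<^sup>2 + (t\<^sup>2 - (real k)\<^sup>2)) / t - 1) (at t)"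
      by (rule derivative_eq_intros D[OF t(1)] refl)+
    ultimately show "\<exists>D. ((\<lambda>t. S t - t) has_real_derivative D) (at t) \<and> 0 \<le> D"
      by (intro exI conjI)
  qed
  \<comment> \<open>Since \<open>S x - x\<close> is nondecreasing from \<open>a\<close> on,
    \<open>S \<ge> 1\<close> holds from \<open>b\<close> on.\<close>
  define b where "b = max a (a - S a + 1)"
  have b: "b \<ge> a" "b > 0" using a by (auto simp: b_def)
  have S_pos: "S x > 0" if "x \<ge> b" for x
    using grow[of x] that by (auto simp: b_def)
  have bound: "ln x + 1 / S x \<le> ln b + 1 / S b" if "x \<ge> b" for x
  proof (rule DERIV_nonpos_imp_nonincreasing[OF that])
    fix t assume t: "b \<le> t" "t \<le> x"
    have pos: "t > 0" "S t > 0" "t \<ge> a" using t b S_pos by auto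
    have "((\<lambda>t. ln t + 1 / S t) has_real_derivative
       1 / t - ((S t)\<^sup>2 + (t\<^sup>2 - (real k)\<^sup>2)) / t / (S t)\<^sup>2) (at t)"
      by (rule DERIV_cong[OF DERIV_add[OF DERIV_ln_divide DERIV_divide[OF DERIV_const D[OF pos(3)]]]])
         (use pos in \<open>simp_all add: power2_eq_square\<close>)
    moreover have "1 / t - ((S t)\<^sup>2 + (t\<^sup>2 - (real k)\<^sup>2)) / t / (S t)\<^sup>2 = - (t\<^sup>2 - (real k)\<^sup>2) / t / (S t)\<^sup>2"
      using pos by (simp add: field_simps)
    moreover have "\<dots> \<le> 0"
      using sq[OF pos(3)] pos a by (intro divide_nonpos_pos) auto
    ultimately show "\<exists>D. ((\<lambda>t. ln t + 1 / S t) has_real_derivative D) (at t) \<and> D \<le> 0"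
      by (intro exI conjI) simp_all
  qed
  \<comment> \<open>Chosen so that \<open>ln x\<close> exceeds the bound
    \<open>ln b + 1 / S b\<close> by 1.\<close>
  define x where "x = exp (ln b + 1 / S b + 1)"
  have "ln x > ln b + 1 / S b" by (simp add: x_def)
  moreover have "x \<ge> b"
  proof -
    have "S b > 0" using S_pos by auto
    hence "ln b \<le> ln b + 1 / S b + 1" by simp
    hence "exp (ln b) \<le> x" unfolding x_def by (simp only: exp_le_cancel_iff)
    thus ?thesis using b by simp
  qed
  ultimately show False using bound[of x] S_pos[of x] by (smt (verit) divide_pos_pos)
qed

section \<open>Enumeration and interlacing of the roots\<close>

lemma infinite_J_zeros: "infinite (J_zeros k)"
proof
  assume fin: "finite (J_zeros k)"
  obtain x where "x > Max (insert 0 (J_zeros k))" "bessel_J k x = 0"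
    using ex_J_zero_greater by blast
  moreover have "Max (insert 0 (J_zeros k)) \<ge> 0" using fin by (intro Max_ge) auto
  ultimately have "x \<in> insert 0 (J_zeros k)" by (auto simp: J_zeros_def)
  hence "x \<le> Max (insert 0 (J_zeros k))" using fin by (intro Max_ge) auto
  thus False using \<open>x > _\<close> by simp
qed

text \<open>Positivity near 0 confines the zeros to the compact interval \<open>[d, M]\<close>, and
  at a zero the derivative is \<open>- bessel_J (Suc k) x\<close>, which is nonzero.\<close>

lemma finite_J_zeros_le: "finite {y \<in> J_zeros k. y \<le> M}"
proof -
  obtain d where d: "d > 0" "\<And>y. 0 < y \<Longrightarrow> y < d \<Longrightarrow> bessel_J k y > 0"
    using bessel_J_pos_near_0[of k] by blast
  have "finite {x \<in> {d..M}. bessel_J k x = 0}"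
  proof (rule finite_simple_zeros)
    fix x assume "x \<in> {d..M}" "bessel_J k x = 0"
    hence "x > 0" using d by auto
    thus "\<exists>D. (bessel_J k has_real_derivative D) (at x) \<and> D \<noteq> 0"
      using DERIV_bessel_J[of x k] no_common_zero[of x k] \<open>bessel_J k x = 0\<close>
      by (auto intro!: exI[of _ "- bessel_J (Suc k) x"])
  qed (intro compact_Icc continuous_intros)+
  moreover have "{y \<in> J_zeros k. y \<le> M} \<subseteq> {x \<in> {d..M}. bessel_J k x = 0}"
    using d(2) by (force simp: J_zeros_def)
  ultimately show ?thesis by (rule finite_subset[rotated])
qed

text \<open>Counting the zeros up to \<open>z l\<close> gives exactly \<open>l\<close>. Hence any
  increasing enumeration of the zeros identifies the roots; the interlacing proof uses this with a
  sequence built from the gaps of another order.\<close>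

lemma bessel_J_root_eq:
  assumes z: "strict_mono_on {1..} z" and im: "z ` {1..} = J_zeros k" and l: "l \<ge> 1"
  shows "bessel_J_root k l = z l"
proof -
  have set: "{y. 0 < y \<and> y \<le> x \<and> bessel_J k y = 0} = {y \<in> z ` {1..}. y \<le> x}" for x
    unfolding im J_zeros_def by auto
  show ?thesis
    unfolding bessel_J_root_def set
  proof (rule the_equality)
    have "z l \<in> J_zeros k" using im l by auto
    thus "0 < z l \<and> bessel_J k (z l) = 0 \<and> card {y \<in> z ` {1..}. y \<le> z l} = l"
      using card_strict_mono_enumeration[OF z l] by (simp add: J_zeros_def)
  next
    fix x assume x: "0 < x \<and> bessel_J k x = 0 \<and> card {y \<in> z ` {1..}. y \<le> x} = l"
    hence "x \<in> z ` {1..}" unfolding im J_zeros_def by simp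
    then obtain m where m: "m \<ge> 1" "x = z m" by auto
    with x card_strict_mono_enumeration[OF z m(1)] show "x = z l" by simp
  qed
qed

lemma bessel_J_root_enumeration:
  "strict_mono_on {1..} (bessel_J_root k)" "bessel_J_root k ` {1..} = J_zeros k"
proof -
  obtain z :: "nat \<Rightarrow> real" where z: "strict_mono_on {1..} z" "z ` {1..} = J_zeros k"
    using ex_strict_mono_enumeration[OF infinite_J_zeros finite_J_zeros_le] by blast
  have eq: "bessel_J_root k l = z l" if "l \<in> {1..}" for l using bessel_J_root_eq[OF z] that by simp
  show "bessel_J_root k ` {1..} = J_zeros k" unfolding z(2)[symmetric] by (intro image_cong eq refl)
  show "strict_mono_on {1..} (bessel_J_root k)"
    using z(1) eq by (simp add: strict_mono_on_def)
qed

lemma bessel_J_root_zero: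
  assumes "l \<ge> 1"
  shows "bessel_J_root k l > 0" "bessel_J k (bessel_J_root k l) = 0"
proof -
  have "bessel_J_root k l \<in> J_zeros k" using bessel_J_root_enumeration(2)[of k] assms by auto
  thus "bessel_J_root k l > 0" "bessel_J k (bessel_J_root k l) = 0" by (auto simp: J_zeros_def)
qed

lemma bessel_J_root_Suc: "l \<ge> 1 \<Longrightarrow> bessel_J_root k l < bessel_J_root k (Suc l)"
  using strict_mono_onD[OF bessel_J_root_enumeration(1)] by simp

lemma bessel_J_root_gap:
  assumes "l \<ge> 1" "bessel_J_root k l < x" "x < bessel_J_root k (Suc l)"
  shows "bessel_J k x \<noteq> 0"
  using strict_mono_enumeration_gap[OF bessel_J_root_enumeration(1) assms]
    bessel_J_root_zero(1)[OF assms(1), of k] assms(2)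
  by (auto simp: bessel_J_root_enumeration J_zeros_def simp del: One_nat_def)

lemma bessel_J_root_1_le:
  assumes "x > 0" "bessel_J k x = 0"
  shows "bessel_J_root k 1 \<le> x"
proof -
  have "x \<in> bessel_J_root k ` {1..}" using assms by (simp del: One_nat_def add: bessel_J_root_enumeration J_zeros_def)
  then obtain m where m: "m \<ge> 1" "x = bessel_J_root k m" by auto
  thus ?thesis using strict_mono_onD[OF bessel_J_root_enumeration(1), of 1 m k] by (cases "m = 1") auto
qed

lemma bessel_J_root_locate:
  assumes "bessel_J_root k 1 \<le> x"
  obtains l where "l \<ge> 1" "bessel_J_root k l \<le> x" "x < bessel_J_root k (Suc l)"
  using strict_mono_enumeration_locate[OF bessel_J_root_enumeration(1) _ assms]
    finite_J_zeros_le[of k x] by (auto simp del: One_nat_def simp: bessel_J_root_enumeration)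

lemma bessel_J_pos_before_root_1:
  assumes "0 < x" "x < bessel_J_root k 1" shows "bessel_J k x > 0"
proof -
  obtain d where d: "d > 0" "\<And>y. 0 < y \<Longrightarrow> y < d \<Longrightarrow> bessel_J k y > 0"
    using bessel_J_pos_near_0[of k] by blast
  define e where "e = min x (d / 2)"
  have e: "0 < e" "e \<le> x" "bessel_J k e > 0" using assms d by (auto simp: e_def)
  have "bessel_J k t \<noteq> 0" if "e \<le> t" "t \<le> x" for t
    using bessel_J_root_1_le[of t k] e that assms by auto
  hence "bessel_J k e * bessel_J k x > 0"
    using e by (intro same_sign_on_interval continuous_intros) auto
  thus ?thesis using e by (simp add: zero_less_mult_iff)
qed

text \<open>The function \<open>x ^ Suc k * bessel_J (Suc k) x\<close> starts from 0 and has
  derivative \<open>x ^ Suc k * bessel_J k x\<close>, positive before the first root of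
  \<open>J\<^sub>k\<close>.\<close>

lemma bessel_J_Suc_pos_upto_root_1:
  assumes "0 < x" "x \<le> bessel_J_root k 1" shows "bessel_J (Suc k) x > 0"
proof -
  have "0 ^ Suc k * bessel_J (Suc k) 0 < x ^ Suc k * bessel_J (Suc k) x"
  proof (rule DERIV_pos_imp_increasing_open[OF assms(1)])
    fix t assume t: "0 < t" "t < x"
    have "((\<lambda>t. t ^ Suc k * bessel_J (Suc k) t) has_real_derivative t ^ Suc k * bessel_J k t) (at t)"
      by (rule DERIV_cong[OF DERIV_mult'[OF DERIV_pow DERIV_bessel_J_Suc]])
         (use t in \<open>simp_all add: algebra_simps add_divide_distrib\<close>)
    moreover have "t ^ Suc k * bessel_J k t > 0"
      using bessel_J_pos_before_root_1[of t k] t assms by simp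
    ultimately show "\<exists>D. ((\<lambda>t. t ^ Suc k * bessel_J (Suc k) t) has_real_derivative D) (at t) \<and> 0 < D"
      by blast
  qed (intro continuous_intros)
  thus ?thesis using assms(1) by (simp add: zero_less_mult_iff del: power_Suc)
qed

text \<open>Dividing by \<open>t\<^sup>k\<close> is the integrating factor that removes the term
  \<open>k f / t\<close>.\<close>

lemma DERIV_divide_power:
  assumes "t > 0" "(f has_real_derivative real k / t * f t - g) (at t)"
  shows "((\<lambda>t. f t / t ^ k) has_real_derivative - g / t ^ k) (at t)"
proof (rule DERIV_cong[OF DERIV_divide[OF assms(2) DERIV_pow]])
  \<comment> \<open>For \<open>k = 0\<close> the exponent is truncated, but both sides are
    0.\<close>
  have "real k * t ^ (k - Suc 0) = real k / t * t ^ k" using assms(1) by (cases k) auto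
  thus "((real k / t * f t - g) * t ^ k - f t * (real k * t ^ (k - Suc 0))) / (t ^ k * t ^ k)
      = - g / t ^ k"
    using assms(1) by (simp add: left_diff_distrib)
qed (use assms in auto)

text \<open>Existence is Rolle's theorem for \<open>J\<^sub>k / t\<^sup>k\<close>. Two zeros of
  \<open>bessel_J (Suc k)\<close> would both be zeros of \<open>J_ratio k\<close>, which is strictly
  increasing in the gap.\<close>

lemma ex1_J_Suc_zero:
  assumes l: "l \<ge> 1"
  shows "\<exists>!y. bessel_J_root k l < y \<and> y < bessel_J_root k (Suc l) \<and> bessel_J (Suc k) y = 0"
proof -
  let ?u = "bessel_J_root k l" and ?v = "bessel_J_root k (Suc l)"
  have u: "?u > 0" "?u < ?v" "bessel_J k ?u = 0" "bessel_J k ?v = 0"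
    using bessel_J_root_zero[of l k] bessel_J_root_zero[of "Suc l" k] bessel_J_root_Suc[OF l] l by auto
  have D: "((\<lambda>t. bessel_J k t / t ^ k) has_real_derivative - bessel_J (Suc k) t / t ^ k) (at t)"
    if "t > 0" for t
    by (rule DERIV_divide_power[OF that DERIV_bessel_J]) (use that in simp)
  have "\<exists>y. ?u < y \<and> y < ?v \<and> DERIV (\<lambda>t. bessel_J k t / t ^ k) y :> 0"
  proof (rule Rolle[OF u(2)])
    show "continuous_on {?u..?v} (\<lambda>t. bessel_J k t / t ^ k)"
      using u by (intro continuous_intros) auto
    show "(\<lambda>t. bessel_J k t / t ^ k) differentiable (at x)" if "?u < x" "x < ?v" for x
      using D[of x] that u by (auto simp: real_differentiable_def)
  qed (use u in auto)
  then obtain y where y: "?u < y" "y < ?v" "DERIV (\<lambda>t. bessel_J k t / t ^ k) y :> 0" by blast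
  have "bessel_J (Suc k) y = 0"
    using DERIV_unique[OF y(3) D[of y]] y(1) u(1) by auto
  moreover have False if "?u < x" "x < y" "y < ?v" "bessel_J (Suc k) x = 0" "bessel_J (Suc k) y = 0" for x y
  proof -
    have "J_ratio k x < J_ratio k y"
      by (rule J_ratio_strict_mono) (use that u bessel_J_root_gap[OF l] in auto)
    thus False using that by (simp add: J_ratio_def)
  qed
  ultimately show ?thesis using y by (intro ex1I[of _ y]) (auto, metis linorder_neqE)
qed

text \<open>\<open>bessel_J (Suc k)\<close> has one zero in each gap between roots of
  \<open>J\<^sub>k\<close>, none at these roots and none before the first. The zeros in the gaps are
  therefore its full increasing enumeration, with matching indices.\<close>

lemma bessel_J_root_interlace:
  assumes "l \<ge> 1"
  shows "bessel_J_root k l < bessel_J_root (Suc k) l" "bessel_J_root (Suc k) l < bessel_J_root k (Suc l)"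
proof -
  define y where "y l = (THE y. bessel_J_root k l < y \<and> y < bessel_J_root k (Suc l) \<and>
      bessel_J (Suc k) y = 0)" for l
  have y: "bessel_J_root k l < y l \<and> y l < bessel_J_root k (Suc l) \<and> bessel_J (Suc k) (y l) = 0"
    if "l \<ge> 1" for l
    unfolding y_def using theI'[OF ex1_J_Suc_zero[OF that]] .
  have mono: "strict_mono_on {1..} y"
    using strict_mono_enumeration_interval_choice[OF bessel_J_root_enumeration(1)] y by blast
  have im: "y ` {1..} = J_zeros (Suc k)"
  proof
    show "y ` {1..} \<subseteq> J_zeros (Suc k)"
      using y bessel_J_root_zero(1)[of _ k] by (force simp: J_zeros_def)
    show "J_zeros (Suc k) \<subseteq> y ` {1..}"
    proof
      fix x assume "x \<in> J_zeros (Suc k)"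
      hence x: "x > 0" "bessel_J (Suc k) x = 0" by (auto simp: J_zeros_def)
      have "bessel_J_root k 1 \<le> x" using bessel_J_Suc_pos_upto_root_1[of x k] x by force
      then obtain l where l: "l \<ge> 1" "bessel_J_root k l \<le> x" "x < bessel_J_root k (Suc l)"
        by (rule bessel_J_root_locate)
      have "x \<noteq> bessel_J_root k l"
        using no_common_zero[OF x(1), of k] x(2) bessel_J_root_zero(2)[OF l(1), of k] by metis
      hence "x = y l" unfolding y_def using the1_equality[OF ex1_J_Suc_zero[OF l(1), of k], of x] l x by simp
      thus "x \<in> y ` {1..}" using l(1) by auto
    qed
  qed
  have "bessel_J_root (Suc k) l = y l" by (rule bessel_J_root_eq[OF mono im assms])
  thus "bessel_J_root k l < bessel_J_root (Suc k) l" "bessel_J_root (Suc k) l < bessel_J_root k (Suc l)"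
    using y[OF assms] by auto
qed

section \<open>Zeros of the characteristic function\<close>

text \<open>The counterpart of \<open>J_energy\<close>: for \<open>x > 0\<close> it is
  \<open>(x\<^sup>2 + k\<^sup>2) I\<^sub>k(x)\<^sup>2 - (x I\<^sub>k'(x))\<^sup>2\<close>, twice the
  integral of \<open>t I\<^sub>k(t)\<^sup>2\<close> over \<open>[0, x]\<close>.\<close>

definition I_energy :: "nat \<Rightarrow> real \<Rightarrow> real" where
  "I_energy k x = (x * bessel_I k x)\<^sup>2
     - 2 * real k * (x * bessel_I k x * bessel_I (Suc k) x) - (x * bessel_I (Suc k) x)\<^sup>2"

lemma DERIV_x_bessel_I:
  assumes "x > 0"
  shows "((\<lambda>x. x * bessel_I k x) has_real_derivative
    (real k + 1) * bessel_I k x + x * bessel_I (Suc k) x) (at x)"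
  by (rule DERIV_cong[OF DERIV_mult'[OF DERIV_ident DERIV_bessel_I]])
     (use assms in \<open>simp_all add: distrib_left distrib_right\<close>)

lemma DERIV_x_bessel_I_Suc:
  assumes "x > 0"
  shows "((\<lambda>x. x * bessel_I (Suc k) x) has_real_derivative
    x * bessel_I k x - real k * bessel_I (Suc k) x) (at x)"
  by (rule DERIV_cong[OF DERIV_mult'[OF DERIV_ident DERIV_bessel_I_Suc]])
     (use assms in \<open>simp_all add: right_diff_distrib distrib_right\<close>)

lemma DERIV_x_bessel_I_mult_Suc:
  assumes "x > 0"
  shows "((\<lambda>x. x * bessel_I k x * bessel_I (Suc k) x) has_real_derivative
    x * (bessel_I k x)\<^sup>2 + x * (bessel_I (Suc k) x)\<^sup>2) (at x)"
  by (rule DERIV_cong[OF DERIV_mult'[OF DERIV_x_bessel_I DERIV_bessel_I_Suc]])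
     (use assms in \<open>simp_all add: algebra_simps add_divide_distrib power2_eq_square\<close>)

lemma DERIV_I_energy:
  assumes "x > 0"
  shows "(I_energy k has_real_derivative 2 * x * (bessel_I k x)\<^sup>2) (at x)"
  unfolding I_energy_def[abs_def]
  by (rule DERIV_cong[OF DERIV_diff[OF DERIV_diff[OF DERIV_power[OF DERIV_x_bessel_I]
       DERIV_cmult[OF DERIV_x_bessel_I_mult_Suc]] DERIV_power[OF DERIV_x_bessel_I_Suc]]])
     (use assms in \<open>simp_all add: algebra_simps power2_eq_square\<close>)

text \<open>The contributions \<open>k J\<^sub>k I\<^sub>k\<close> of the two derivative formulas
  cancel. What remains combines \<open>bessel_J k x\<close> and \<open>bessel_J (Suc k) x\<close>
  with positive coefficients.\<close>

lemma F_fun_eq: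
  assumes "\<kappa> > 0" "x > 0"
  shows "F_fun k \<kappa> x = \<kappa> / x * bessel_I (Suc k) (\<kappa> / x) * bessel_J k x
    + bessel_I k (\<kappa> / x) * (x * bessel_J (Suc k) x)"
proof -
  have p: "x \<noteq> 0" "\<kappa> / x \<noteq> 0" using assms by auto
  have J: "x * deriv (bessel_J k) x = real k * bessel_J k x - x * bessel_J (Suc k) x"
    using DERIV_imp_deriv[OF DERIV_bessel_J[OF p(1), of k]] p by (simp add: right_diff_distrib)
  have I: "\<kappa> / x * deriv (bessel_I k) (\<kappa> / x)
      = real k * bessel_I k (\<kappa> / x) + \<kappa> / x * bessel_I (Suc k) (\<kappa> / x)"
    unfolding DERIV_imp_deriv[OF DERIV_bessel_I[OF p(2), of k]] distrib_left using p by simp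
  have "F_fun k \<kappa> x = bessel_J k x * (\<kappa> / x * deriv (bessel_I k) (\<kappa> / x))
      - bessel_I k (\<kappa> / x) * (x * deriv (bessel_J k) x)"
    unfolding F_fun_def by (simp add: mult_ac)
  thus ?thesis unfolding I J by (simp add: algebra_simps)
qed

text \<open>With \<open>R(r) = I\<^sub>k(\<beta>) J\<^sub>k(\<alpha>r) - J\<^sub>k(\<alpha>) I\<^sub>k(\<beta>r)\<close> the function \<open>E\<close> below has derivative
  \<open>r (R' - k R / r)\<^sup>2\<close>, and up to a positive factor \<open>E 1\<close> is the left-hand side of the claim.\<close>

lemma energy_at_F_zero:
  assumes al: "\<alpha> > 0" and be: "\<beta> > 0" and nz: "bessel_J k \<alpha> \<noteq> 0"
    and F0: "\<beta> * bessel_I (Suc k) \<beta> * bessel_J k \<alpha> + bessel_I k \<beta> * (\<alpha> * bessel_J (Suc k) \<alpha>) = 0"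
  shows "4 * real k * \<beta> * bessel_I k \<beta> * bessel_I (Suc k) \<beta> + 2 * \<beta>\<^sup>2 * (bessel_I (Suc k) \<beta>)\<^sup>2
    + (\<alpha>\<^sup>2 - \<beta>\<^sup>2) * (bessel_I k \<beta>)\<^sup>2 > 0" (is "?K > 0")
proof -
  define P Q where "P = bessel_I k \<beta>" and "Q = bessel_J k \<alpha>"
  \<comment> \<open>Chosen so that the mixed term in \<open>a\<close> and \<open>b\<close> drops out
    of the derivative of \<open>E\<close>; see the last factor in \<open>alg\<close>.\<close>
  define g where "g = (\<beta>\<^sup>2 - \<alpha>\<^sup>2) / (\<alpha>\<^sup>2 + \<beta>\<^sup>2)"
  have sum_pos: "\<alpha>\<^sup>2 + \<beta>\<^sup>2 > 0" using al be by (simp add: add_pos_pos)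
  have g: "g * (\<alpha>\<^sup>2 + \<beta>\<^sup>2) = \<beta>\<^sup>2 - \<alpha>\<^sup>2" using sum_pos by (simp add: g_def)
  \<comment> \<open>With \<open>R = a - b\<close>, these four functions satisfy
    \<open>r R' = k R - (s + t)\<close>, so \<open>(s + t)\<^sup>2 / r\<close> is the intended
    derivative of \<open>E\<close>.\<close>
  define a where "a r = P * bessel_J k (\<alpha> * r)" for r
  define b where "b r = Q * bessel_I k (\<beta> * r)" for r
  define s where "s r = P * (\<alpha> * r * bessel_J (Suc k) (\<alpha> * r))" for r
  define t where "t r = Q * (\<beta> * r * bessel_I (Suc k) (\<beta> * r))" for r
  define E where "E r = - ((a r - b r) * (s r + t r)) + g * (s r * b r + t r * a r)
     + P\<^sup>2 / 2 * J_energy k (\<alpha> * r) - Q\<^sup>2 / 2 * I_energy k (\<beta> * r)" for r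
  have Da: "(a has_real_derivative real k / r * a r - s r / r) (at r)" if "r > 0" for r
    unfolding a_def[abs_def] s_def
    by (rule DERIV_cong[OF DERIV_cmult[OF DERIV_chain2[OF DERIV_bessel_J DERIV_cmult_Id]]])
       (use that al in \<open>simp_all add: algebra_simps\<close>)
  have Db: "(b has_real_derivative real k / r * b r + t r / r) (at r)" if "r > 0" for r
    unfolding b_def[abs_def] t_def
    by (rule DERIV_cong[OF DERIV_cmult[OF DERIV_chain2[OF DERIV_bessel_I DERIV_cmult_Id]]])
       (use that be in \<open>simp_all add: algebra_simps\<close>)
  have Ds: "(s has_real_derivative \<alpha>\<^sup>2 * r * a r - real k / r * s r) (at r)" if "r > 0" for r
    unfolding s_def[abs_def] a_def
    by (rule DERIV_cong[OF DERIV_cmult[OF DERIV_chain2[OF DERIV_x_bessel_J_Suc DERIV_cmult_Id]]])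
       (use that al in \<open>simp_all add: algebra_simps power2_eq_square\<close>)
  have Dt: "(t has_real_derivative \<beta>\<^sup>2 * r * b r - real k / r * t r) (at r)" if "r > 0" for r
    unfolding t_def[abs_def] b_def
    by (rule DERIV_cong[OF DERIV_cmult[OF DERIV_chain2[OF DERIV_x_bessel_I_Suc DERIV_cmult_Id]]])
       (use that be in \<open>simp_all add: algebra_simps power2_eq_square\<close>)
  have DA: "((\<lambda>r. P\<^sup>2 / 2 * J_energy k (\<alpha> * r)) has_real_derivative \<alpha>\<^sup>2 * r * (a r)\<^sup>2) (at r)" if "r > 0" for r
    unfolding a_def
    by (rule DERIV_cong[OF DERIV_cmult[OF DERIV_chain2[OF DERIV_J_energy DERIV_cmult_Id]]])
       (use that al in \<open>simp_all add: power2_eq_square\<close>)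
  have DB: "((\<lambda>r. Q\<^sup>2 / 2 * I_energy k (\<beta> * r)) has_real_derivative \<beta>\<^sup>2 * r * (b r)\<^sup>2) (at r)" if "r > 0" for r
    unfolding b_def
    by (rule DERIV_cong[OF DERIV_cmult[OF DERIV_chain2[OF DERIV_I_energy DERIV_cmult_Id]]])
       (use that be in \<open>simp_all add: power2_eq_square\<close>)
  have DE: "(E has_real_derivative (s r + t r)\<^sup>2 / r) (at r)" if "r > 0" for r
  proof -
    \<comment> \<open>Treating \<open>1 / r\<close> as an independent variable \<open>i\<close>
      makes \<open>alg\<close> a polynomial identity.\<close>
    define A B S T i K where v: "A = a r" "B = b r" "S = s r" "T = t r" "i = 1 / r" "K = real k"
    have alg: "- ((A - B) * ((\<alpha>\<^sup>2 * r * A - K * i * S) + (\<beta>\<^sup>2 * r * B - K * i * T))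
          + ((K * i * A - S * i) - (K * i * B + T * i)) * (S + T))
        + g * ((S * (K * i * B + T * i) + (\<alpha>\<^sup>2 * r * A - K * i * S) * B)
          + (T * (K * i * A - S * i) + (\<beta>\<^sup>2 * r * B - K * i * T) * A))
        + \<alpha>\<^sup>2 * r * A\<^sup>2 - \<beta>\<^sup>2 * r * B\<^sup>2
        = (S + T)\<^sup>2 * i + r * A * B * (g * (\<alpha>\<^sup>2 + \<beta>\<^sup>2) - (\<beta>\<^sup>2 - \<alpha>\<^sup>2))"
      by (simp add: algebra_simps power2_eq_square)
    have "(E has_real_derivative
        - ((A - B) * ((\<alpha>\<^sup>2 * r * A - K * i * S) + (\<beta>\<^sup>2 * r * B - K * i * T))
          + ((K * i * A - S * i) - (K * i * B + T * i)) * (S + T))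
        + g * ((S * (K * i * B + T * i) + (\<alpha>\<^sup>2 * r * A - K * i * S) * B)
          + (T * (K * i * A - S * i) + (\<beta>\<^sup>2 * r * B - K * i * T) * A))
        + \<alpha>\<^sup>2 * r * A\<^sup>2 - \<beta>\<^sup>2 * r * B\<^sup>2) (at r)"
      unfolding E_def[abs_def] v
      by (rule DERIV_cong[OF DERIV_diff[OF DERIV_add[OF DERIV_add[OF
            DERIV_minus[OF DERIV_mult'[OF DERIV_diff[OF Da[OF that] Db[OF that]] DERIV_add[OF Ds[OF that] Dt[OF that]]]]
            DERIV_cmult[OF DERIV_add[OF DERIV_mult'[OF Ds[OF that] Db[OF that]] DERIV_mult'[OF Dt[OF that] Da[OF that]]]]]
            DA[OF that]] DB[OF that]]]) simp
    thus ?thesis unfolding alg g by (simp add: v)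
  qed
  have contE: "continuous_on S E" for S
    unfolding E_def[abs_def] a_def b_def s_def t_def J_energy_def I_energy_def
    by (intro continuous_intros)
  \<comment> \<open>These are the boundary conditions at \<open>r = 1\<close>: \<open>F0\<close>
    gives \<open>s + t = 0\<close>, and the choice of \<open>P\<close> and \<open>Q\<close> gives
    \<open>a = b\<close>. They remove everything from \<open>E 1\<close> except the two
    energies.\<close>
  have st1: "s 1 + t 1 = 0" using F0 by (simp add: s_def t_def P_def Q_def mult_ac)
  have ab1: "a 1 = b 1" by (simp add: a_def b_def P_def Q_def)
  have E1: "2 * E 1 = Q\<^sup>2 * ?K"
  proof -
    define S T where "S = s 1" and "T = \<beta> * bessel_I (Suc k) \<beta>"
    have t1: "t 1 = Q * T" and S: "S = - (Q * T)"
      using st1 by (simp_all add: S_def T_def t_def)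
    have "2 * E 1 = P\<^sup>2 * J_energy k \<alpha> - Q\<^sup>2 * I_energy k \<beta>"
      using st1 ab1 by (simp add: E_def distrib_right[symmetric])
    also have "P\<^sup>2 * J_energy k \<alpha> = S\<^sup>2 - 2 * real k * (P * Q * S) + (\<alpha> * P * Q)\<^sup>2"
      by (simp add: S_def s_def J_energy_def Q_def[symmetric] algebra_simps power2_eq_square)
    also have "Q\<^sup>2 * I_energy k \<beta> = Q\<^sup>2 * ((\<beta> * P)\<^sup>2 - 2 * real k * (P * T) - T\<^sup>2)"
      by (simp add: T_def I_energy_def P_def[symmetric] mult_ac)
    also have "S\<^sup>2 - 2 * real k * (P * Q * S) + (\<alpha> * P * Q)\<^sup>2
        - Q\<^sup>2 * ((\<beta> * P)\<^sup>2 - 2 * real k * (P * T) - T\<^sup>2)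
        = Q\<^sup>2 * (4 * real k * (P * T) + 2 * T\<^sup>2 + (\<alpha>\<^sup>2 - \<beta>\<^sup>2) * P\<^sup>2)"
      unfolding S by (simp add: algebra_simps power2_eq_square)
    also have "\<dots> = Q\<^sup>2 * ?K"
      by (simp add: T_def P_def power_mult_distrib mult_ac)
    finally show ?thesis .
  qed
  \<comment> \<open>Otherwise \<open>E\<close>, nondecreasing from \<open>E 0 = 0\<close>, vanishes
    on the unit interval. Then \<open>s + t = 0\<close> there, so \<open>(a - b) / r\<^sup>k\<close>
    is constant and \<open>a = b\<close>. Differentiating \<open>s + t\<close> gives
    \<open>(\<alpha>\<^sup>2 + \<beta>\<^sup>2) r b = 0\<close>, although \<open>b\<close> is
    nonzero.\<close>
  have "E 1 > 0"
  proof (rule ccontr)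
    assume neg: "\<not> E 1 > 0"
    have mono: "E x \<le> E y" if "0 \<le> x" "x \<le> y" for x y
    proof (rule DERIV_nonneg_imp_increasing_open[OF that(2)])
      fix u assume "x < u" "u < y"
      thus "\<exists>D. (E has_real_derivative D) (at u) \<and> 0 \<le> D"
        using DE[of u] that by (auto intro!: exI[of _ "(s u + t u)\<^sup>2 / u"])
    qed (rule contE)
    have "E 0 = 0" by (simp add: E_def s_def t_def J_energy_def I_energy_def)
    hence E0: "E r = 0" if "r \<in> {0<..<1}" for r
      using mono[of 0 r] mono[of r 1] that neg by auto
    have st: "s r + t r = 0" if r: "r \<in> {0<..<1}" for r
    proof -
      have "(E has_real_derivative 0) (at r)"
        by (rule has_field_derivative_transform_within_open[OF DERIV_const[of 0] open_greaterThanLessThan r])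
           (simp add: E0)
      from DERIV_unique[OF this DE[of r]] show ?thesis using r by simp
    qed
    have ab: "a r = b r" if r: "r \<in> {0<..<1}" for r
    proof -
      have "(a 1 - b 1) / 1 ^ k = (a r - b r) / r ^ k"
      proof (rule DERIV_isconst_end[where f = "\<lambda>r. (a r - b r) / r ^ k"])
        show "continuous_on {r..1} (\<lambda>r. (a r - b r) / r ^ k)"
          unfolding a_def b_def using r by (intro continuous_intros) auto
        fix x assume x: "r < x" "x < 1"
        have "((\<lambda>r. a r - b r) has_real_derivative real k / x * (a x - b x) - 0) (at x)"
          by (rule DERIV_cong[OF DERIV_diff[OF Da Db]])
             (use st[of x] x r in \<open>auto simp: algebra_simps add_divide_distrib[symmetric]\<close>)
        from DERIV_divide_power[OF _ this]
        show "((\<lambda>r. (a r - b r) / r ^ k) has_real_derivative 0) (at x)"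
          using x r by simp
      qed (use r in auto)
      thus ?thesis using ab1 r by simp
    qed
    have half: "(1/2::real) \<in> {0<..<1}" by simp
    have "((\<lambda>r. s r + t r) has_real_derivative 0) (at (1/2))"
      by (rule has_field_derivative_transform_within_open[OF DERIV_const[of 0] open_greaterThanLessThan half])
         (simp add: st)
    from DERIV_unique[OF this DERIV_add[OF Ds Dt]]
    have "\<alpha>\<^sup>2 * (1/2) * b (1/2) + \<beta>\<^sup>2 * (1/2) * b (1/2) - 2 * real k * (s (1/2) + t (1/2)) = 0"
      using ab[OF half] by (simp add: algebra_simps)
    hence "(\<alpha>\<^sup>2 + \<beta>\<^sup>2) * b (1/2) = 0" unfolding st[OF half] by (simp add: algebra_simps)
    moreover have "b (1/2) \<noteq> 0"
      using nz bessel_I_pos[of "\<beta> * (1/2)" k] be by (simp add: b_def Q_def)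
    ultimately show False using sum_pos by simp
  qed
  hence "Q\<^sup>2 * ?K > 0" using E1 by linarith
  thus ?thesis by (simp add: zero_less_mult_iff)
qed

section \<open>Simplicity, location and existence of the zeros\<close>

lemma F_zero_imp_J_nonzero:
  assumes "\<kappa> > 0" "x > 0" "F_fun k \<kappa> x = 0"
  shows "bessel_J k x \<noteq> 0"
proof
  assume "bessel_J k x = 0"
  hence "bessel_I k (\<kappa> / x) * (x * bessel_J (Suc k) x) = 0"
    using F_fun_eq[OF assms(1,2), of k] assms(3) by simp
  moreover have "bessel_I k (\<kappa> / x) > 0" using assms by (intro bessel_I_pos) auto
  ultimately show False using no_common_zero[OF assms(2) \<open>bessel_J k x = 0\<close>] assms(2) by simp
qed

text \<open>In these abbreviations the function is \<open>T * Q + P * S\<close>. The inner function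
  \<open>\<kappa> / x\<close> has derivative \<open>- (\<kappa> / x) / x\<close>, and each of the
  four product terms is brought to the common factor \<open>1 / x\<close> separately.\<close>

lemma DERIV_F_fun:
  fixes k
  assumes "\<kappa> > 0" "x > 0"
  defines "P \<equiv> bessel_I k (\<kappa> / x)" and "T \<equiv> \<kappa> / x * bessel_I (Suc k) (\<kappa> / x)"
    and "Q \<equiv> bessel_J k x" and "S \<equiv> x * bessel_J (Suc k) x"
  shows "(F_fun k \<kappa> has_real_derivative
    (2 * real k * T * Q - 2 * real k * P * S - 2 * S * T + (x\<^sup>2 - (\<kappa> / x)\<^sup>2) * P * Q) / x) (at x)"
proof -
  let ?b = "\<kappa> / x"
  have b: "?b > 0" "?b \<noteq> 0" using assms by auto
  have Db: "((\<lambda>x. \<kappa> / x) has_real_derivative - ?b / x) (at x)"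
    by (rule DERIV_cong[OF DERIV_divide[OF DERIV_const DERIV_ident]])
       (use assms in simp_all)
  have "((\<lambda>x. \<kappa> / x * bessel_I (Suc k) (\<kappa> / x) * bessel_J k x
      + bessel_I k (\<kappa> / x) * (x * bessel_J (Suc k) x)) has_real_derivative
      (T * (real k / x * Q - bessel_J (Suc k) x)
        + ((?b * P - real k * bessel_I (Suc k) ?b) * (- ?b / x)) * Q)
      + (P * (x * Q - real k * bessel_J (Suc k) x)
        + ((real k / ?b * P + bessel_I (Suc k) ?b) * (- ?b / x)) * S)) (at x)"
    unfolding P_def Q_def S_def T_def
    using DERIV_add[OF DERIV_mult'[OF DERIV_chain2[OF DERIV_x_bessel_I_Suc[OF b(1)] Db] DERIV_bessel_J]
        DERIV_mult'[OF DERIV_chain2[OF DERIV_bessel_I[OF b(2)] Db] DERIV_x_bessel_J_Suc[OF assms(2)]]]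
      assms(2) by simp
  also have "(T * (real k / x * Q - bessel_J (Suc k) x)
        + ((?b * P - real k * bessel_I (Suc k) ?b) * (- ?b / x)) * Q)
      + (P * (x * Q - real k * bessel_J (Suc k) x)
        + ((real k / ?b * P + bessel_I (Suc k) ?b) * (- ?b / x)) * S)
      = (2 * real k * T * Q - 2 * real k * P * S - 2 * S * T + (x\<^sup>2 - (\<kappa> / x)\<^sup>2) * P * Q) / x"
  proof -
    define c i where "c = ?b" and "i = 1 / x"
    have c: "c \<noteq> 0" "bessel_I (Suc k) c = T / c" "bessel_J (Suc k) x = S * i" "x * i = 1"
      using b assms(2) by (simp_all add: c_def T_def S_def i_def)
    have e1: "T * (real k / x * Q - S * i) = i * (real k * T * Q - S * T)"
      by (simp add: i_def algebra_simps diff_divide_distrib)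
    have e2: "((c * P - real k * (T / c)) * (- c / x)) * Q = i * (real k * T * Q - c\<^sup>2 * P * Q)"
          proof -
      have "(c * P - real k * (T / c)) * (- c) = real k * T - c\<^sup>2 * P"
        using c(1) by (simp add: left_diff_distrib power2_eq_square)
      hence "((c * P - real k * (T / c)) * (- c / x)) = (real k * T - c\<^sup>2 * P) / x"
        by (metis times_divide_eq_right)
      thus ?thesis by (simp only:) (simp add: i_def left_diff_distrib right_diff_distrib diff_divide_distrib mult_ac)
    qed
    have e3: "P * (x * Q - real k * (S * i)) = i * (x\<^sup>2 * P * Q - real k * P * S)"
      using assms(2) by (simp add: i_def diff_divide_distrib power2_eq_square algebra_simps)
    have e4: "((real k / c * P + T / c) * (- c / x)) * S = i * (- real k * P * S - S * T)"
      using c(1) by (simp add: i_def add_divide_distrib distrib_right diff_divide_distrib algebra_simps)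
    show ?thesis
      unfolding c_def[symmetric] c(2,3) e1 e2 e3 e4
      by (simp add: i_def algebra_simps diff_divide_distrib add_divide_distrib)
  qed
  finally show ?thesis
    by (rule has_field_derivative_transform_within_open[of _ _ _ "{0<..}"])
       (use assms in \<open>auto simp: F_fun_eq\<close>)
qed

lemma continuous_on_F_fun:
  assumes "\<kappa> > 0" "a > 0"
  shows "continuous_on {a..b} (F_fun k \<kappa>)"
proof (rule DERIV_atLeastAtMost_imp_continuous_on)
  fix x assume "a \<le> x"
  hence "x > 0" using assms(2) by simp
  thus "\<exists>D. (F_fun k \<kappa> has_real_derivative D) (at x)" using DERIV_F_fun[OF assms(1)] by blast
qed

text \<open>The factor \<open>D\<close> is the energy of \<open>energy_at_F_zero\<close>, up to normalisation.\<close>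

lemma DERIV_F_fun_at_zero:
  assumes "\<kappa> > 0" "x > 0" "F_fun k \<kappa> x = 0"
  shows "\<exists>D>0. (F_fun k \<kappa> has_real_derivative bessel_J k x * D) (at x)"
proof -
  define P T Q S where v: "P = bessel_I k (\<kappa> / x)" "T = \<kappa> / x * bessel_I (Suc k) (\<kappa> / x)"
    "Q = bessel_J k x" "S = x * bessel_J (Suc k) x"
  define K where "K = 4 * real k * P * T + 2 * T\<^sup>2 + (x\<^sup>2 - (\<kappa> / x)\<^sup>2) * P\<^sup>2"
  have b: "\<kappa> / x > 0" using assms by simp
  have P: "P > 0" unfolding v using b by (rule bessel_I_pos)
  have F0: "T * Q + P * S = 0" using F_fun_eq[OF assms(1,2), of k] assms(3) by (simp add: v)
  have "K > 0"
    using energy_at_F_zero[OF assms(2) b F_zero_imp_J_nonzero[OF assms]] F0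
    unfolding K_def v power_mult_distrib by (simp add: mult_ac)
  moreover have "(2 * real k * T * Q - 2 * real k * P * S - 2 * S * T + (x\<^sup>2 - (\<kappa> / x)\<^sup>2) * P * Q) / x
      = Q * (K / (P * x))"
  proof -
    \<comment> \<open>After multiplication by \<open>P\<close>, the unknown \<open>S\<close> occurs
      only in \<open>P * S\<close>, which the equation \<open>F0\<close> replaces by
      \<open>- (T * Q)\<close>.\<close>
    have PS: "P * S = - (T * Q)" using F0 by linarith
    have "P * (2 * real k * T * Q - 2 * real k * P * S - 2 * S * T + (x\<^sup>2 - (\<kappa> / x)\<^sup>2) * P * Q)
       = 2 * real k * P * T * Q - 2 * real k * P * (P * S) - 2 * (P * S) * T + (x\<^sup>2 - (\<kappa> / x)\<^sup>2) * P\<^sup>2 * Q"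
      by (simp add: algebra_simps power2_eq_square)
    also have "\<dots> = Q * K" unfolding PS K_def by (simp add: algebra_simps power2_eq_square)
    finally have "2 * real k * T * Q - 2 * real k * P * S - 2 * S * T + (x\<^sup>2 - (\<kappa> / x)\<^sup>2) * P * Q = Q * K / P"
      using P by (metis less_numeral_extra(3) nonzero_mult_div_cancel_left)
    thus ?thesis by simp
  qed
  ultimately show ?thesis
    using DERIV_F_fun[OF assms(1,2), of k] P assms(2) unfolding v[symmetric]
    by (intro exI[of _ "K / (P * x)"]) simp
qed

text \<open>A combination with positive coefficients \<open>p\<close>, \<open>q\<close> vanishes;
  multiplying it by \<open>bessel_J k x\<close> exhibits the sign of the product.\<close>

lemma F_zero_opposite_signs:
  assumes "\<kappa> > 0" "x > 0" "F_fun k \<kappa> x = 0"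
  shows "bessel_J k x * bessel_J (Suc k) x < 0"
proof -
  define p q where "p = \<kappa> / x * bessel_I (Suc k) (\<kappa> / x)" and "q = bessel_I k (\<kappa> / x) * x"
  have pos: "p > 0" "q > 0" using assms by (simp_all add: p_def q_def bessel_I_pos)
  have "p * bessel_J k x + q * bessel_J (Suc k) x = 0"
    using F_fun_eq[OF assms(1,2), of k] assms(3) by (simp add: p_def q_def mult_ac)
  hence "q * (bessel_J k x * bessel_J (Suc k) x) = - (p * (bessel_J k x)\<^sup>2)"
    by (simp add: power2_eq_square algebra_simps) (metis add.inverse_unique mult.left_commute mult_minus_right)
  also have "\<dots> < 0" using pos F_zero_imp_J_nonzero[OF assms] by simp
  finally show ?thesis using pos by (simp add: mult_less_0_iff)
qed

text \<open>Elsewhere the signs cannot be opposite: both Bessel functions are positive before the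
  first root of \<open>J\<^sub>k\<close>, and in the rest of each gap the increasing
  \<open>J_ratio k\<close> has passed its zero and is positive.\<close>

lemma F_zero_located:
  assumes "\<kappa> > 0" "x > 0" "F_fun k \<kappa> x = 0"
  obtains l where "l \<ge> 1" "bessel_J_root k l < x" "x < bessel_J_root (Suc k) l"
proof -
  note sgn = F_zero_opposite_signs[OF assms]
  have "bessel_J_root k 1 \<le> x"
  proof (rule ccontr)
    assume "\<not> ?thesis"
    hence "bessel_J k x > 0" "bessel_J (Suc k) x > 0"
      using bessel_J_pos_before_root_1[of x k] bessel_J_Suc_pos_upto_root_1[of x k] assms(2) by auto
    hence "bessel_J k x * bessel_J (Suc k) x > 0" by simp
    thus False using sgn by simp
  qed
  then obtain l where l: "l \<ge> 1" "bessel_J_root k l \<le> x" "x < bessel_J_root k (Suc l)"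
    by (rule bessel_J_root_locate)
  have neq: "bessel_J_root k l \<noteq> x" "bessel_J_root (Suc k) l \<noteq> x"
    using bessel_J_root_zero(2)[OF l(1), of k] bessel_J_root_zero(2)[OF l(1), of "Suc k"] sgn by force+
  note il = bessel_J_root_interlace[OF l(1), of k]
  have "x < bessel_J_root (Suc k) l"
  proof (rule ccontr)
    let ?y = "bessel_J_root (Suc k) l"
    assume "\<not> ?thesis"
    hence "?y < x" using neq by simp
    have "J_ratio k ?y < J_ratio k x"
      using \<open>?y < x\<close> bessel_J_root_zero(1)[OF l(1), of "Suc k"] bessel_J_root_gap[OF l(1), of k] l il
      by (intro J_ratio_strict_mono) auto
    hence "bessel_J (Suc k) x / bessel_J k x > 0"
      using assms(2) by (simp add: J_ratio_def bessel_J_root_zero(2)[OF l(1)] zero_less_mult_iff zero_less_divide_iff mult_less_0_iff)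
    thus False using sgn by (auto simp: zero_less_divide_iff mult_less_0_iff)
  qed
  thus ?thesis using that l neq by force
qed

text \<open>\<open>J\<^sub>k\<close> keeps its sign in the gap, so multiplying
  \<open>F_fun k \<kappa>\<close> by the constant \<open>bessel_J k x\<close> makes the derivative
  positive at every zero.\<close>

lemma F_zero_unique:
  assumes "\<kappa> > 0" and l: "l \<ge> 1"
    and x: "bessel_J_root k l < x" "x < bessel_J_root k (Suc l)" "F_fun k \<kappa> x = 0"
    and y: "bessel_J_root k l < y" "y < bessel_J_root k (Suc l)" "F_fun k \<kappa> y = 0"
  shows "x = y"
proof -
  have False if "bessel_J_root k l < x" "x < y" "y < bessel_J_root k (Suc l)"
    "F_fun k \<kappa> x = 0" "F_fun k \<kappa> y = 0" for x y
  proof (rule zeros_with_positive_derivative_unique[OF \<open>x < y\<close>,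
        where f = "\<lambda>t. bessel_J k x * F_fun k \<kappa> t"])
    have x0: "x > 0" using bessel_J_root_zero(1)[OF l, of k] that by simp
    have "continuous_on {x..y} (F_fun k \<kappa>)" using assms(1) x0 by (rule continuous_on_F_fun)
    thus "continuous_on {x..y} (\<lambda>t. bessel_J k x * F_fun k \<kappa> t)" by (intro continuous_intros)
    fix t assume t: "x \<le> t" "t \<le> y" "bessel_J k x * F_fun k \<kappa> t = 0"
    have "bessel_J k x * bessel_J k t > 0"
      using bessel_J_root_gap[OF l, of k] that t
      by (intro same_sign_on_interval continuous_intros) auto
    moreover have "F_fun k \<kappa> t = 0" using t(3) calculation by auto
    then obtain D where "D > 0" "(F_fun k \<kappa> has_real_derivative bessel_J k t * D) (at t)"
      using DERIV_F_fun_at_zero[OF assms(1), of t k] x0 t by auto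
    hence "((\<lambda>t. bessel_J k x * F_fun k \<kappa> t) has_real_derivative bessel_J k x * bessel_J k t * D) (at t)"
      using DERIV_cmult[of "F_fun k \<kappa>" "bessel_J k t * D"] by (simp add: mult.assoc)
    ultimately show "\<exists>D>0. ((\<lambda>t. bessel_J k x * F_fun k \<kappa> t) has_real_derivative D) (at t)"
      using \<open>D > 0\<close> mult_pos_pos by blast
  qed (use that in auto)
  thus ?thesis using x y by (metis linorder_neqE)
qed

text \<open>At the left end \<open>F_fun\<close> is a positive multiple of
  \<open>bessel_J (Suc k)\<close>, at the right end of \<open>bessel_J k\<close>. Since
  \<open>J_ratio k\<close> is negative in between, these two values have opposite signs.\<close>

lemma ex_F_zero:
  assumes "\<kappa> > 0" and l: "l \<ge> 1"
  shows "\<exists>x. bessel_J_root k l < x \<and> x < bessel_J_root (Suc k) l \<and> F_fun k \<kappa> x = 0"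
proof -
  let ?u = "bessel_J_root k l" and ?v = "bessel_J_root (Suc k) l"
  note il = bessel_J_root_interlace[OF l, of k]
  have u: "?u > 0" "bessel_J k ?u = 0" and v: "?v > 0" "bessel_J (Suc k) ?v = 0"
    using bessel_J_root_zero[OF l] by auto
  \<comment> \<open>Each Bessel function vanishes at one end, so signs are compared inside:
    \<open>bessel_J (Suc k)\<close> keeps its sign on \<open>[?u, m]\<close>, and
    \<open>bessel_J k\<close> on \<open>[m, ?v]\<close>.\<close>
  define m where "m = (?u + ?v) / 2"
  have m: "?u < m" "m < ?v" using il by (auto simp: m_def)
  have ratio: "J_ratio k t < 0" if "?u < t" "t < ?v" for t
  proof -
    have "J_ratio k t < J_ratio k ?v"
      by (rule J_ratio_strict_mono) (use that u il bessel_J_root_gap[OF l, of k] in auto)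
    thus ?thesis by (simp add: J_ratio_def v)
  qed
  have "bessel_J (Suc k) ?u * bessel_J (Suc k) m > 0"
  proof (rule same_sign_on_interval[where f = "bessel_J (Suc k)"])
    fix t assume t: "?u \<le> t" "t \<le> m"
    show "bessel_J (Suc k) t \<noteq> 0"
      using no_common_zero[OF u] ratio[of t] t m by (cases "t = ?u") (auto simp: J_ratio_def)
  qed (use m in \<open>auto intro!: continuous_on_bessel_J continuous_on_id\<close>)
  moreover have "bessel_J k m * bessel_J k ?v > 0"
    using bessel_J_root_gap[OF l, of k] m il
    by (intro same_sign_on_interval continuous_intros) auto
  moreover have "bessel_J (Suc k) m * bessel_J k m < 0"
    using ratio[OF m] m u by (auto simp: J_ratio_def divide_less_0_iff mult_less_0_iff zero_less_mult_iff)
  ultimately have opp: "bessel_J (Suc k) ?u * bessel_J k ?v < 0"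
    by (auto simp: mult_less_0_iff zero_less_mult_iff)
  have Fu: "F_fun k \<kappa> ?u = bessel_I k (\<kappa> / ?u) * ?u * bessel_J (Suc k) ?u"
    and Fv: "F_fun k \<kappa> ?v = \<kappa> / ?v * bessel_I (Suc k) (\<kappa> / ?v) * bessel_J k ?v"
    using F_fun_eq[OF assms(1) u(1), of k] F_fun_eq[OF assms(1) v(1), of k] u v by auto
  have pos: "bessel_I k (\<kappa> / ?u) * ?u > 0" "\<kappa> / ?v * bessel_I (Suc k) (\<kappa> / ?v) > 0"
    using assms(1) u v by (auto intro!: mult_pos_pos divide_pos_pos bessel_I_pos)
  have neg: "F_fun k \<kappa> ?u * F_fun k \<kappa> ?v < 0"
    using mult_pos_neg[OF mult_pos_pos[OF pos] opp] unfolding Fu Fv by (simp only: mult_ac)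
  have "continuous_on {?u..?v} (F_fun k \<kappa>)"
    using assms(1) u(1) by (rule continuous_on_F_fun)
  hence "\<exists>t. ?u \<le> t \<and> t \<le> ?v \<and> F_fun k \<kappa> t = 0"
    using neg same_sign_on_interval[of ?u ?v "F_fun k \<kappa>"] il by force
  then obtain t where t: "?u \<le> t" "t \<le> ?v" "F_fun k \<kappa> t = 0" by blast
  moreover have "t \<noteq> ?u" "t \<noteq> ?v" using neg t(3) by auto
  ultimately show ?thesis by (intro exI[of _ t]) auto
qed

section \<open>The eigenvalue problem on the disc\<close>

lemma partial_deriv_eq: "(u has_derivative u') (at x) \<Longrightarrow> partial_deriv b u x = u' b"
  unfolding partial_deriv_def by (metis frechet_derivative_at)

lemma Cn_on_UNIV_SucI:
  fixes u :: "'a::euclidean_space \<Rightarrow> 'b::real_normed_vector"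
  assumes "\<And>x. (u has_derivative D x) (at x)"
    and "\<And>b. b \<in> Basis \<Longrightarrow> Cn_on n UNIV (\<lambda>x. D x b)"
  shows "Cn_on (Suc n) UNIV u"
proof -
  have "partial_deriv b u = (\<lambda>x. D x b)" for b
    using partial_deriv_eq[OF assms(1)] by blast
  thus ?thesis using assms by (auto simp: differentiable_def)
qed

text \<open>\<open>Cn_on\<close> recurses through partial derivatives, so inclusion of the classes
  takes an induction. Products need it, because the partial derivatives of \<open>u v\<close>
  contain \<open>u\<close> and \<open>v\<close> themselves.\<close>

lemma Cn_on_Suc_imp: "Cn_on (Suc n) S u \<Longrightarrow> Cn_on n S u"
proof (induction n arbitrary: u)
  case 0
  thus ?case
    by (auto intro!: continuous_at_imp_continuous_on differentiable_imp_continuous_within)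
next
  case (Suc n)
  thus ?case by (metis Cn_on.simps(2))
qed

lemma Cn_on_UNIV_D:
  assumes "Cn_on (Suc n) UNIV u"
  shows "(u has_derivative (\<lambda>h. frechet_derivative u (at x) h)) (at x)"
    "b \<in> Basis \<Longrightarrow> Cn_on n UNIV (\<lambda>x. frechet_derivative u (at x) b)"
  using assms by (auto simp: frechet_derivative_works[symmetric] partial_deriv_def[abs_def])

lemma Cn_on_const: "Cn_on n UNIV (\<lambda>x. c)"
proof (induction n arbitrary: c)
  case (Suc n)
  show ?case by (rule Cn_on_UNIV_SucI[OF has_derivative_const Suc])
qed simp

lemma Cn_on_linear:
  assumes "bounded_linear u" shows "Cn_on n UNIV u"
proof (cases n)
  case (Suc m)
  show ?thesis unfolding Suc
    by (rule Cn_on_UNIV_SucI[OF bounded_linear_imp_has_derivative[OF assms] Cn_on_const])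
qed (auto intro: linear_continuous_on assms)

lemma Cn_on_add:
  "Cn_on n UNIV u \<Longrightarrow> Cn_on n UNIV v \<Longrightarrow> Cn_on n UNIV (\<lambda>x. u x + v x)"
proof (induction n arbitrary: u v)
  case (Suc n)
  show ?case
    by (rule Cn_on_UNIV_SucI[OF has_derivative_add[OF Cn_on_UNIV_D(1)[OF Suc(2)] Cn_on_UNIV_D(1)[OF Suc(3)]]])
       (intro Suc(1) Cn_on_UNIV_D(2)[OF Suc(2)] Cn_on_UNIV_D(2)[OF Suc(3)])
qed (auto intro: continuous_intros)

lemma Cn_on_mult:
  fixes u v :: "'a::euclidean_space \<Rightarrow> 'b::real_normed_algebra"
  shows "Cn_on n UNIV u \<Longrightarrow> Cn_on n UNIV v \<Longrightarrow> Cn_on n UNIV (\<lambda>x. u x * v x)"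
proof (induction n arbitrary: u v)
  case (Suc n)
  show ?case
    by (rule Cn_on_UNIV_SucI[OF has_derivative_mult[OF Cn_on_UNIV_D(1)[OF Suc(2)] Cn_on_UNIV_D(1)[OF Suc(3)]]])
       (intro Cn_on_add Suc(1) Cn_on_UNIV_D(2)[OF Suc(2)] Cn_on_UNIV_D(2)[OF Suc(3)]
         Cn_on_Suc_imp[OF Suc(2)] Cn_on_Suc_imp[OF Suc(3)])
qed (auto intro: continuous_intros)

lemma Cn_on_power:
  fixes u :: "'a::euclidean_space \<Rightarrow> 'b::real_normed_algebra_1"
  assumes "Cn_on n UNIV u"
  shows "Cn_on n UNIV (\<lambda>x. u x ^ k)"
  by (induction k) (auto intro: Cn_on_const Cn_on_mult assms)

section \<open>Smooth modes on the plane and their Laplacian\<close>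

definition radial_clifford :: "nat \<Rightarrow> real \<Rightarrow> real ^ 2 \<Rightarrow> complex" where
  "radial_clifford j c x = of_real (clifford j (c * (x \<bullet> x)))"

text \<open>A function of \<open>|x|\<^sup>2\<close> has no trouble at the origin. The derivative
  stays in the family, with index raised by one and a linear factor, which makes smoothness an
  induction over all \<open>j\<close>.\<close>

lemma has_derivative_radial_clifford:
  "(radial_clifford j c has_derivative
    (\<lambda>h. of_real (2 * c * (x \<bullet> h)) * radial_clifford (Suc j) c x)) (at x)"
proof -
  have "((\<lambda>x. clifford j (c * (x \<bullet> x))) has_derivative
      (\<lambda>h. c * (x \<bullet> h + h \<bullet> x) * clifford (Suc j) (c * (x \<bullet> x)))) (at x)"
    by (rule DERIV_compose_FDERIV[OF DERIV_clifford]) (intro derivative_intros)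
  from has_derivative_of_real[OF this, where ?'a = complex]
  show ?thesis
    unfolding radial_clifford_def[abs_def]
    by (rule has_derivative_eq_rhs) (auto simp: inner_commute)
qed

lemma Cn_on_radial_clifford: "Cn_on n UNIV (radial_clifford j c)"
proof (induction n arbitrary: j)
  case 0
  show ?case using has_derivative_radial_clifford
    by (auto intro!: continuous_at_imp_continuous_on has_derivative_continuous)
next
  case (Suc n)
  show ?case
  proof (rule Cn_on_UNIV_SucI[OF has_derivative_radial_clifford])
    fix b :: "real ^ 2"
    have "bounded_linear (\<lambda>x. complex_of_real (2 * c * (x \<bullet> b)))"
      by (intro bounded_linear_compose[OF bounded_linear_of_real]
          bounded_linear_const_mult bounded_linear_inner_left)
    thus "Cn_on n UNIV (\<lambda>x. complex_of_real (2 * c * (x \<bullet> b)) * radial_clifford (Suc j) c x)"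
      by (intro Cn_on_mult Cn_on_linear Suc)
  qed
qed

text \<open>For \<open>e = \<plusminus>\<i>\<close> this is the complex coordinate \<open>x\<^sub>1 \<plusminus> \<i> x\<^sub>2\<close>.\<close>

definition zeta :: "complex \<Rightarrow> real ^ 2 \<Rightarrow> complex" where
  "zeta e x = of_real (x $ 1) + e * of_real (x $ 2)"

lemma bounded_linear_zeta: "bounded_linear (zeta e)"
  unfolding zeta_def[abs_def]
  by (intro bounded_linear_add bounded_linear_compose[OF bounded_linear_of_real]
      bounded_linear_const_mult bounded_linear_vec_nth)

lemma zeta_scaleR: "zeta e (r *\<^sub>R x) = of_real r * zeta e x"
  by (simp add: zeta_def algebra_simps)

text \<open>With \<open>c = - \<alpha>\<^sup>2 / 4\<close> and the factor
  \<open>(\<alpha> / 2)\<^sup>k\<close> this is \<open>J\<^sub>k(\<alpha> r)\<close> times the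
  angular factor; \<open>c = \<beta>\<^sup>2 / 4\<close> and \<open>(\<beta> / 2)\<^sup>k\<close>
  give \<open>I\<^sub>k(\<beta> r)\<close>.\<close>

definition disc_mode :: "complex \<Rightarrow> nat \<Rightarrow> real \<Rightarrow> real ^ 2 \<Rightarrow> complex" where
  "disc_mode e k c x = zeta e x ^ k * radial_clifford k c x"

lemma Cn_on_disc_mode: "Cn_on n UNIV (disc_mode e k c)"
  unfolding disc_mode_def[abs_def]
  by (intro Cn_on_mult Cn_on_power Cn_on_linear bounded_linear_zeta Cn_on_radial_clifford)

lemma has_derivative_zeta_power:
  "((\<lambda>x. zeta e x ^ k) has_derivative (\<lambda>h. of_nat k * zeta e h * zeta e x ^ (k - 1))) (at x)"
  using has_derivative_power[OF bounded_linear_imp_has_derivative[OF bounded_linear_zeta], of e k x UNIV]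
  by simp

lemma laplacian_real2:
  fixes u :: "real ^ 2 \<Rightarrow> 'b::real_normed_vector"
  shows "laplacian u x = partial_deriv (axis 1 1) (partial_deriv (axis 1 1) u) x
    + partial_deriv (axis 2 1) (partial_deriv (axis 2 1) u) x"
proof -
  have basis: "(Basis :: (real ^ 2) set) = {axis 1 1, axis 2 1}"
    by (auto simp: Basis_vec_def UNIV_2)
  have "axis 1 1 \<noteq> (axis 2 1 :: real ^ 2)" by (simp add: axis_eq_axis)
  thus ?thesis unfolding laplacian_def basis by simp
qed

text \<open>Product rule, applied twice. The truncated exponents \<open>k - 1\<close> and
  \<open>k - 2\<close> are harmless, since the prefactors \<open>k\<close> and
  \<open>k (k - 1)\<close> vanish whenever truncation occurs.\<close>

lemma second_partial_disc_mode:
  "partial_deriv b (partial_deriv b (disc_mode e k c)) x =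
     of_nat k * of_nat (k - 1) * zeta e b ^ 2 * zeta e x ^ (k - 2) * radial_clifford k c x
     + 4 * of_real c * of_nat k * zeta e x ^ (k - 1) * (zeta e b * of_real (x \<bullet> b)) * radial_clifford (Suc k) c x
     + 2 * of_real c * of_real (b \<bullet> b) * zeta e x ^ k * radial_clifford (Suc k) c x
     + 4 * of_real c ^ 2 * of_real (x \<bullet> b) ^ 2 * zeta e x ^ k * radial_clifford (Suc (Suc k)) c x"
proof -
  have 1: "partial_deriv b (disc_mode e k c) = (\<lambda>x. 
      zeta e x ^ k * (of_real (2 * c * (x \<bullet> b)) * radial_clifford (Suc k) c x)
      + of_nat k * zeta e b * zeta e x ^ (k - 1) * radial_clifford k c x)"
    unfolding disc_mode_def[abs_def]
    by (rule ext, rule partial_deriv_eq[OF has_derivative_mult[OF has_derivative_zeta_power has_derivative_radial_clifford]])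
  have 2: "((\<lambda>x. complex_of_real (2 * c * (x \<bullet> b))) has_derivative (\<lambda>h. of_real (2 * c * (h \<bullet> b)))) (at x)"
    by (intro bounded_linear_imp_has_derivative bounded_linear_compose[OF bounded_linear_of_real]
          bounded_linear_const_mult bounded_linear_inner_left)
  have "partial_deriv b (partial_deriv b (disc_mode e k c)) x =
    zeta e x ^ k * (of_real (2 * c * (x \<bullet> b)) * (of_real (2 * c * (x \<bullet> b)) * radial_clifford (Suc (Suc k)) c x)
       + of_real (2 * c * (b \<bullet> b)) * radial_clifford (Suc k) c x)
     + (of_nat k * zeta e b * zeta e x ^ (k - 1)) * (of_real (2 * c * (x \<bullet> b)) * radial_clifford (Suc k) c x)
     + (of_nat k * zeta e b * zeta e x ^ (k - 1) * (of_real (2 * c * (x \<bullet> b)) * radial_clifford (Suc k) c x)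
       + of_nat k * zeta e b * (of_nat (k - 1) * zeta e b * zeta e x ^ (k - 1 - 1)) * radial_clifford k c x)"
    unfolding 1
    by (rule partial_deriv_eq[OF has_derivative_add[OF
          has_derivative_mult[OF has_derivative_zeta_power has_derivative_mult[OF 2 has_derivative_radial_clifford]]
          has_derivative_mult[OF has_derivative_mult_right[OF has_derivative_zeta_power] has_derivative_radial_clifford]]])
  thus ?thesis by (simp add: algebra_simps power2_eq_square numeral_2_eq_2)
qed

text \<open>\<open>\<zeta>\<^sup>k\<close> is harmonic because \<open>1 + e * e = 0\<close>, and
  homogeneous of degree \<open>k\<close>, which evaluates the cross term. The remaining sum is the
  right-hand side of \<open>clifford_rec\<close>.\<close>

lemma laplacian_disc_mode:
  assumes e: "e * e = -1"
  shows "laplacian (disc_mode e k c) x = of_real (4 * c) * disc_mode e k c x"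
proof -
  define Z Y0 Y1 Y2 X1 X2 C where v: "Z = zeta e x" "Y0 = radial_clifford k c x"
    "Y1 = radial_clifford (Suc k) c x" "Y2 = radial_clifford (Suc (Suc k)) c x"
    "X1 = complex_of_real (x $ 1)" "X2 = complex_of_real (x $ 2)" "C = complex_of_real c"
  have "x \<bullet> x = (x $ 1)\<^sup>2 + (x $ 2)\<^sup>2"
    by (simp add: inner_vec_def sum_2 power2_eq_square)
  hence rec: "Y0 = (of_nat k + 1) * Y1 + C * (X1\<^sup>2 + X2\<^sup>2) * Y2"
    unfolding v radial_clifford_def by (subst clifford_rec) (simp add: algebra_simps)
  have Z: "Z = X1 + e * X2" by (simp add: v zeta_def)
  have kZ: "of_nat k * Z ^ (k - 1) * Z = of_nat k * Z ^ k" by (cases k) auto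
  have za: "zeta e (axis 1 1) = 1" "zeta e (axis 2 1) = e"
    "x \<bullet> axis 1 1 = x $ 1" "x \<bullet> axis 2 1 = x $ 2"
    "axis 1 1 \<bullet> (axis 1 1 :: real ^ 2) = 1" "axis 2 1 \<bullet> (axis 2 1 :: real ^ 2) = 1"
    by (simp_all add: zeta_def axis_def inner_vec_def sum_2)
  have "laplacian (disc_mode e k c) x =
     of_nat k * of_nat (k - 1) * (1 + e * e) * Z ^ (k - 2) * Y0
     + 4 * C * (of_nat k * Z ^ (k - 1) * (X1 + e * X2)) * Y1
     + 4 * C * Z ^ k * Y1 + 4 * C ^ 2 * (X1\<^sup>2 + X2\<^sup>2) * Z ^ k * Y2"
    unfolding laplacian_real2 second_partial_disc_mode za v[symmetric]
    by (simp add: algebra_simps power2_eq_square)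
  also have "\<dots> = 4 * C * Z ^ k * ((of_nat k + 1) * Y1 + C * (X1\<^sup>2 + X2\<^sup>2) * Y2)"
    unfolding e Z[symmetric] kZ by (simp add: algebra_simps power2_eq_square)
  finally show ?thesis unfolding rec[symmetric] by (simp add: disc_mode_def v mult_ac)
qed

lemma laplacian_linear_combination:
  fixes u v :: "real ^ 2 \<Rightarrow> complex"
  assumes "Cn_on 2 UNIV u" "Cn_on 2 UNIV v"
  shows "laplacian (\<lambda>x. a * u x + b * v x) x = a * laplacian u x + b * laplacian v x"
proof -
  have step: "partial_deriv i (\<lambda>x. a * f x + b * g x) =
      (\<lambda>x. a * partial_deriv i f x + b * partial_deriv i g x)"
    if "\<And>x. f differentiable (at x)" "\<And>x. g differentiable (at x)" for f g :: "real ^ 2 \<Rightarrow> complex" and i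
  proof
    fix x
    have "(f has_derivative frechet_derivative f (at x)) (at x)"
      "(g has_derivative frechet_derivative g (at x)) (at x)"
      using that frechet_derivative_works by blast+
    from partial_deriv_eq[OF has_derivative_add[OF has_derivative_mult_right[OF this(1)]
        has_derivative_mult_right[OF this(2)]], of i a b]
    show "partial_deriv i (\<lambda>x. a * f x + b * g x) x = a * partial_deriv i f x + b * partial_deriv i g x"
      by (simp add: partial_deriv_def)
  qed
  have "u differentiable (at x)" "v differentiable (at x)" for x
    using assms by (auto simp: numeral_2_eq_2)
  moreover have "partial_deriv i u differentiable (at x)" "partial_deriv i v differentiable (at x)"
    if "i \<in> Basis" for x i
    using assms that by (auto simp: numeral_2_eq_2)
  ultimately show ?thesis
    by (simp add: laplacian_def step sum.distrib sum_distrib_left)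
qed

section \<open>Polar coordinates and boundary conditions\<close>

lemma norm_real2: "norm (x :: real ^ 2) = cmod (Complex (x $ 1) (x $ 2))"
  by (simp add: norm_vec_def L2_set_def sum_2 cmod_def)

lemma radial_profile_eq:
  "radial_profile k \<kappa> \<alpha> c d r =
     c * of_real ((\<alpha> / 2) ^ k) * (of_real r ^ k * of_real (clifford k (- \<alpha>\<^sup>2 / 4 * r\<^sup>2)))
   + d * of_real ((\<kappa> / \<alpha> / 2) ^ k) * (of_real r ^ k * of_real (clifford k ((\<kappa> / \<alpha>)\<^sup>2 / 4 * r\<^sup>2)))"
proof -
  have "bessel_J k (\<alpha> * r) = (\<alpha> / 2) ^ k * (r ^ k * clifford k (- \<alpha>\<^sup>2 / 4 * r\<^sup>2))"
    unfolding bessel_J_eq by (simp add: power_mult_distrib power_divide)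
  moreover have "bessel_I k (\<kappa> / \<alpha> * r) = (\<kappa> / \<alpha> / 2) ^ k * (r ^ k * clifford k ((\<kappa> / \<alpha>)\<^sup>2 / 4 * r\<^sup>2))"
    unfolding bessel_I_eq by (simp add: power_mult_distrib power_divide)
  ultimately show ?thesis unfolding radial_profile_def by (simp add: mult_ac)
qed

text \<open>De Moivre's formula for \<open>?z\<close> or its conjugate. At the origin both sides are
  \<open>0\<^sup>k\<close>.\<close>

lemma cis_power_zeta:
  assumes "(e, m) \<in> {(\<i>, int k), (-\<i>, - int k)}"
  shows "of_real (norm x) ^ k * cis (of_int m * Arg (Complex (x $ 1) (x $ 2))) = zeta e x ^ k"
proof -
  let ?z = "Complex (x $ 1) (x $ 2)"
  have "zeta \<i> x = ?z" "zeta (- \<i>) x = cnj ?z"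
    by (simp_all add: zeta_def complex_eq_iff)
  moreover have z: "?z = of_real (norm x) * cis (Arg ?z)"
    unfolding norm_real2 using rcis_cmod_Arg[of ?z] by (simp add: rcis_def)
  moreover have "cnj ?z = of_real (norm x) * cis (- Arg ?z)"
    by (subst z) (simp add: cis_cnj)
  moreover have "?z ^ k = of_real (norm x) ^ k * cis (real k * Arg ?z)"
    by (subst z) (simp add: power_mult_distrib Complex.DeMoivre)
  ultimately show ?thesis using assms by (auto simp: power_mult_distrib Complex.DeMoivre)
qed

lemma polar_fun_radial_profile_eq:
  assumes "(e, m) \<in> {(\<i>, int k), (-\<i>, - int k)}"
  shows "polar_fun (radial_profile k \<kappa> \<alpha> c d) m =
    (\<lambda>x. c * of_real ((\<alpha> / 2) ^ k) * disc_mode e k (- \<alpha>\<^sup>2 / 4) x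
       + d * of_real ((\<kappa> / \<alpha> / 2) ^ k) * disc_mode e k ((\<kappa> / \<alpha>)\<^sup>2 / 4) x)"
  unfolding polar_fun_def[abs_def] radial_profile_eq disc_mode_def radial_clifford_def
    cis_power_zeta[OF assms, symmetric] power2_norm_eq_inner[symmetric]
  by (simp add: algebra_simps)

text \<open>Passing through \<open>zeta\<close> covers every real \<open>r\<close>, also negative
  ones, where the polar angle jumps. The boundary conditions thereby reduce to the profile and its
  derivative at 1.\<close>

lemma polar_fun_scaleR:
  assumes "norm x = 1" "m \<in> {int k, - int k}"
  shows "polar_fun (radial_profile k \<kappa> \<alpha> c d) m (r *\<^sub>R x)
    = radial_profile k \<kappa> \<alpha> c d r * cis (of_int m * Arg (Complex (x $ 1) (x $ 2)))"
proof -
  obtain e where e: "(e, m) \<in> {(\<i>, int k), (-\<i>, - int k)}" using assms(2) by auto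
  have c: "zeta e x ^ k = cis (of_int m * Arg (Complex (x $ 1) (x $ 2)))"
    using cis_power_zeta[OF e, of x] assms(1) by simp
  have "(r *\<^sub>R x) \<bullet> (r *\<^sub>R x) = r\<^sup>2"
    using assms(1) by (simp add: power2_norm_eq_inner[symmetric] power_mult_distrib)
  thus ?thesis
    unfolding polar_fun_radial_profile_eq[OF e] radial_profile_eq disc_mode_def radial_clifford_def
      zeta_scaleR power_mult_distrib c
    by (simp add: algebra_simps)
qed

lemma has_vector_derivative_radial_profile:
  assumes "\<alpha> > 0" "\<kappa> > 0"
  shows "(radial_profile k \<kappa> \<alpha> c d has_vector_derivative
    (c * of_real (\<alpha> * deriv (bessel_J k) \<alpha>) + d * of_real (\<kappa> / \<alpha> * deriv (bessel_I k) (\<kappa> / \<alpha>)))) (at 1)"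
proof -
  have nz: "\<alpha> \<noteq> 0" "\<kappa> / \<alpha> \<noteq> 0" using assms by auto
  have J: "(bessel_J k has_real_derivative deriv (bessel_J k) \<alpha>) (at (\<alpha> * 1))"
    using DERIV_bessel_J[OF nz(1), of k] DERIV_imp_deriv by fastforce
  have I: "(bessel_I k has_real_derivative deriv (bessel_I k) (\<kappa> / \<alpha>)) (at (\<kappa> / \<alpha> * 1))"
    using DERIV_bessel_I[OF nz(2), of k] DERIV_imp_deriv by fastforce
  have "((\<lambda>r. complex_of_real (bessel_J k (\<alpha> * r))) has_vector_derivative
      of_real (deriv (bessel_J k) \<alpha> * \<alpha>)) (at 1)"
    using DERIV_chain2[OF J DERIV_cmult_Id]
    by (intro has_vector_derivative_of_real)
  moreover have "((\<lambda>r. complex_of_real (bessel_I k (\<kappa> / \<alpha> * r))) has_vector_derivative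
      of_real (deriv (bessel_I k) (\<kappa> / \<alpha>) * (\<kappa> / \<alpha>))) (at 1)"
    using DERIV_chain2[OF I DERIV_cmult_Id]
    by (intro has_vector_derivative_of_real)
  ultimately show ?thesis
    unfolding radial_profile_def[abs_def] mult.commute[of \<alpha> "deriv _ _"] mult.commute[of "\<kappa> / \<alpha>" "deriv _ _"]
    by (intro has_vector_derivative_add has_vector_derivative_mult_right)
qed

text \<open>The Laplacian acts on the two modes by \<open>- \<alpha>\<^sup>2\<close> and
  \<open>\<beta>\<^sup>2\<close>. With \<open>\<kappa> = \<alpha> \<beta>\<close> and
  \<open>\<lambda> = \<alpha>\<^sup>2 - \<beta>\<^sup>2\<close> these are the roots of
  \<open>\<mu>\<^sup>2 + \<lambda> \<mu> - \<kappa>\<^sup>2 = 0\<close>. The boundary conditions are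
  the two equations of the system.\<close>

lemma is_eigenfunction_polar_fun:
  assumes pos: "\<alpha> > 0" "\<kappa> > 0" and sys: "boundary_system k \<kappa> \<alpha> c d"
    and r: "0 \<le> r" "r < 1" "radial_profile k \<kappa> \<alpha> c d r \<noteq> 0"
    and m: "m \<in> {int k, - int k}"
  shows "is_eigenfunction \<kappa> (\<alpha>\<^sup>2 - \<kappa>\<^sup>2 / \<alpha>\<^sup>2) (polar_fun (radial_profile k \<kappa> \<alpha> c d) m)"
proof -
  let ?R = "radial_profile k \<kappa> \<alpha> c d"
  let ?u = "polar_fun ?R m"
  obtain e where e: "(e, m) \<in> {(\<i>, int k), (-\<i>, - int k)}" using m by auto
  hence ee: "e * e = -1" by auto
  define \<beta> where "\<beta> = \<kappa> / \<alpha>"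
  define A B where "A = disc_mode e k (- \<alpha>\<^sup>2 / 4)" and "B = disc_mode e k (\<beta>\<^sup>2 / 4)"
  have u: "?u = (\<lambda>x. c * of_real ((\<alpha> / 2) ^ k) * A x + d * of_real ((\<beta> / 2) ^ k) * B x)"
    unfolding polar_fun_radial_profile_eq[OF e] A_def B_def \<beta>_def ..
  have CA: "Cn_on n UNIV A" and CB: "Cn_on n UNIV B" for n
    unfolding A_def B_def by (rule Cn_on_disc_mode)+
  have "laplacian A x = of_real (- \<alpha>\<^sup>2) * A x" "laplacian B x = of_real (\<beta>\<^sup>2) * B x" for x
    unfolding A_def B_def laplacian_disc_mode[OF ee] by simp_all
  \<comment> \<open>An equality of functions with arbitrary coefficients, so that it can be applied
    a second time for the bilaplacian.\<close>
  hence lap: "laplacian (\<lambda>x. p * A x + q * B x) =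
      (\<lambda>x. (p * of_real (- \<alpha>\<^sup>2)) * A x + (q * of_real (\<beta>\<^sup>2)) * B x)" for p q
    unfolding laplacian_linear_combination[OF CA CB, abs_def] by (simp add: mult.assoc)
  have \<kappa>: "\<kappa> = \<alpha> * \<beta>" "\<kappa>\<^sup>2 / \<alpha>\<^sup>2 = \<beta>\<^sup>2" using pos by (simp_all add: \<beta>_def power_divide)
  have pde: "laplacian (laplacian ?u) x - complex_of_real (\<kappa>\<^sup>2) * ?u x
      = - complex_of_real (\<alpha>\<^sup>2 - \<kappa>\<^sup>2 / \<alpha>\<^sup>2) * laplacian ?u x" for x
    unfolding u lap \<kappa>(2) unfolding \<kappa>(1) by (simp add: algebra_simps power2_eq_square)
  have "Cn_on 4 UNIV ?u" unfolding u by (intro Cn_on_add Cn_on_mult Cn_on_const CA CB)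
  hence smooth: "\<exists>U. open U \<and> cball 0 1 \<subseteq> U \<and> Cn_on 4 U ?u" by (intro exI[of _ UNIV]) simp
  have R1: "?R 1 = 0" using sys by (simp add: radial_profile_def boundary_system_def)
  have dR: "(?R has_vector_derivative 0) (at 1)"
    using has_vector_derivative_radial_profile[OF pos, of k c d] sys by (simp add: boundary_system_def)
  have bdry: "?u x = 0 \<and> ((\<lambda>r. ?u (r *\<^sub>R x)) has_vector_derivative 0) (at 1)" if "x \<in> sphere 0 1" for x
  proof
    have x: "norm x = 1" using that by simp
    show "?u x = 0" using polar_fun_scaleR[OF x m, of \<kappa> \<alpha> c d 1] R1 by simp
    show "((\<lambda>r. ?u (r *\<^sub>R x)) has_vector_derivative 0) (at 1)"
      unfolding polar_fun_scaleR[OF x m]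
      using has_vector_derivative_mult_left[OF dR] by simp
  qed
  have "?u (r *\<^sub>R axis 1 1) \<noteq> 0"
    using r(3) by (subst polar_fun_scaleR[OF _ m]) (auto simp: norm_axis_1)
  moreover have "r *\<^sub>R axis 1 1 \<in> ball (0 :: real ^ 2) 1" using r by (simp add: norm_axis_1)
  ultimately show ?thesis using smooth pde bdry unfolding is_eigenfunction_def by blast
qed

section \<open>From the zeros to eigenvalues and eigenfunctions\<close>

lemma ex_F_zero_enumeration:
  assumes "\<kappa> > 0"
  shows "\<exists>\<alpha>. strict_mono_on {1..} \<alpha> \<and> \<alpha> ` {1..} = {a. a > 0 \<and> F_fun k \<kappa> a = 0} \<and>
    (\<forall>l\<ge>1. bessel_J_root k l < \<alpha> l \<and> \<alpha> l < bessel_J_root (Suc k) l)"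
proof -
  have "\<forall>l. \<exists>x. l \<ge> 1 \<longrightarrow>
      bessel_J_root k l < x \<and> x < bessel_J_root (Suc k) l \<and> F_fun k \<kappa> x = 0"
    using ex_F_zero[OF assms] by blast
  from choice[OF this] obtain \<alpha> where \<alpha>: "\<And>l. l \<ge> 1 \<Longrightarrow>
      bessel_J_root k l < \<alpha> l \<and> \<alpha> l < bessel_J_root (Suc k) l \<and> F_fun k \<kappa> (\<alpha> l) = 0"
    by blast
  have gap: "bessel_J_root k l < \<alpha> l \<and> \<alpha> l < bessel_J_root k (Suc l)" if "l \<ge> 1" for l
    using \<alpha>[OF that] bessel_J_root_interlace(2)[OF that, of k] by linarith
  have "strict_mono_on {1..} \<alpha>"
    by (rule strict_mono_enumeration_interval_choice[OF bessel_J_root_enumeration(1) gap])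
  moreover have "\<alpha> ` {1..} = {a. a > 0 \<and> F_fun k \<kappa> a = 0}"
  proof
    show "\<alpha> ` {1..} \<subseteq> {a. a > 0 \<and> F_fun k \<kappa> a = 0}"
      using \<alpha> bessel_J_root_zero(1)[of _ k] by force
    show "{a. a > 0 \<and> F_fun k \<kappa> a = 0} \<subseteq> \<alpha> ` {1..}"
    proof
      fix a assume "a \<in> {a. a > 0 \<and> F_fun k \<kappa> a = 0}"
      hence a: "a > 0" "F_fun k \<kappa> a = 0" by auto
      obtain l where l: "l \<ge> 1" "bessel_J_root k l < a" "a < bessel_J_root (Suc k) l"
        using F_zero_located[OF assms a] by blast
      \<comment> \<open>Both points lie in the same gap between consecutive roots of
        \<open>J\<^sub>k\<close>, where the zero is unique.\<close>
      have "a = \<alpha> l"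
        using F_zero_unique[OF assms l(1), of k a "\<alpha> l"] a l \<alpha>[OF l(1)] gap[OF l(1)]
          bessel_J_root_interlace(2)[OF l(1), of k] by linarith
      thus "a \<in> \<alpha> ` {1..}" using l(1) by auto
    qed
  qed
  ultimately show ?thesis using \<alpha> by blast
qed

text \<open>\<open>F_fun k \<kappa> a\<close> is the determinant of the system. The witness solves
  the first equation identically and the second because the determinant vanishes; its first entry is
  positive.\<close>

lemma ex_boundary_system_solution:
  assumes "\<kappa> > 0" "a > 0" "F_fun k \<kappa> a = 0"
  shows "\<exists>c d. (c, d) \<noteq> (0, 0) \<and> boundary_system k \<kappa> a c d"
proof (intro exI conjI)
  let ?c = "complex_of_real (bessel_I k (\<kappa> / a))" and ?d = "- complex_of_real (bessel_J k a)"
  show "(?c, ?d) \<noteq> (0, 0)" using bessel_I_pos[of "\<kappa> / a" k] assms by simp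
  have "bessel_I k (\<kappa> / a) * (a * deriv (bessel_J k) a)
      - bessel_J k a * (\<kappa> / a * deriv (bessel_I k) (\<kappa> / a)) = 0"
    using assms(3) unfolding F_fun_def by (simp add: mult_ac)
  hence "?c * of_real (a * deriv (bessel_J k) a) + ?d * of_real (\<kappa> / a * deriv (bessel_I k) (\<kappa> / a)) = 0"
    by (simp only: mult_minus_left add_uminus_conv_diff of_real_mult[symmetric] of_real_diff[symmetric] of_real_0)
  thus "boundary_system k \<kappa> a ?c ?d" unfolding boundary_system_def by (simp add: mult.commute)
qed

text \<open>At \<open>r = j\<^sub>k\<^sub>,\<^sub>l / a\<close> the \<open>J\<close>-part of the profile vanishes and the \<open>I\<close>-part does not.\<close>

lemma radial_profile_nontrivial:
  assumes "\<kappa> > 0" "F_fun k \<kappa> a = 0" and l: "l \<ge> 1" "bessel_J_root k l < a"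
    and cd: "(c, d) \<noteq> (0, 0)" "boundary_system k \<kappa> a c d"
  shows "\<exists>r. 0 \<le> r \<and> r < 1 \<and> radial_profile k \<kappa> a c d r \<noteq> 0"
proof -
  define r where "r = bessel_J_root k l / a"
  note j = bessel_J_root_zero[OF l(1), of k]
  have a: "a > 0" using j(1) l(2) by linarith
  have r: "0 < r" "r < 1" using a j l by (simp_all add: r_def)
  have "bessel_J k a \<noteq> 0" by (rule F_zero_imp_J_nonzero[OF assms(1) a assms(2)])
  \<comment> \<open>With \<open>d = 0\<close> the first equation would force
    \<open>c = 0\<close>.\<close>
  hence "d \<noteq> 0" using cd by (auto simp: boundary_system_def)
  moreover have "bessel_I k (\<kappa> / a * r) \<noteq> 0"
    using bessel_I_pos[of "\<kappa> / a * r" k] assms(1) a r by simp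
  moreover have "bessel_J k (a * r) = 0" using j a by (simp add: r_def)
  ultimately have "radial_profile k \<kappa> a c d r \<noteq> 0" by (simp add: radial_profile_def)
  thus ?thesis using r by (intro exI[of _ r]) simp
qed

theorem theorem7:
  fixes k :: nat and \<kappa> :: real
  assumes "\<kappa> > 0"
  shows "(\<forall>a>0. F_fun k \<kappa> a = 0 \<longrightarrow>
            (\<exists>D. (F_fun k \<kappa> has_real_derivative D) (at a) \<and> D \<noteq> 0)) \<and>
         (\<exists>\<alpha> :: nat \<Rightarrow> real.
            strict_mono_on {1..} \<alpha> \<and>
            \<alpha> ` {1..} = {a. a > 0 \<and> F_fun k \<kappa> a = 0} \<and>
            (\<forall>l\<ge>1. bessel_J_root k l < \<alpha> l \<and> \<alpha> l < bessel_J_root (k + 1) l) \<and>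
            (\<forall>l\<ge>1. is_eigenvalue \<kappa> ((\<alpha> l)\<^sup>2 - \<kappa>\<^sup>2 / (\<alpha> l)\<^sup>2) \<and>
               (\<exists>c d. (c, d) \<noteq> (0, 0) \<and> boundary_system k \<kappa> (\<alpha> l) c d) \<and>
               (\<forall>c d. (c, d) \<noteq> (0, 0) \<and> boundary_system k \<kappa> (\<alpha> l) c d \<longrightarrow>
                  (\<forall>m\<in>{int k, - int k}.
                     is_eigenfunction \<kappa> ((\<alpha> l)\<^sup>2 - \<kappa>\<^sup>2 / (\<alpha> l)\<^sup>2)
                       (polar_fun (radial_profile k \<kappa> (\<alpha> l) c d) m)))))"
proof
  show "\<forall>a>0. F_fun k \<kappa> a = 0 \<longrightarrow>
      (\<exists>D. (F_fun k \<kappa> has_real_derivative D) (at a) \<and> D \<noteq> 0)"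
  proof (intro allI impI)
    fix a :: real assume a: "a > 0" "F_fun k \<kappa> a = 0"
    obtain D where "D > 0" "(F_fun k \<kappa> has_real_derivative bessel_J k a * D) (at a)"
      using DERIV_F_fun_at_zero[OF assms a] by blast
    thus "\<exists>D. (F_fun k \<kappa> has_real_derivative D) (at a) \<and> D \<noteq> 0"
      using F_zero_imp_J_nonzero[OF assms a] by (intro exI[of _ "bessel_J k a * D"]) simp
  qed
next
  obtain \<alpha> where \<alpha>: "strict_mono_on {1..} \<alpha>" "\<alpha> ` {1..} = {a. a > 0 \<and> F_fun k \<kappa> a = 0}"
    "\<forall>l\<ge>1. bessel_J_root k l < \<alpha> l \<and> \<alpha> l < bessel_J_root (Suc k) l"
    using ex_F_zero_enumeration[OF assms] by blast
  have zero: "\<alpha> l > 0" "F_fun k \<kappa> (\<alpha> l) = 0" if "l \<ge> 1" for l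
    using \<alpha>(2) that by auto
  have eigen: "is_eigenfunction \<kappa> ((\<alpha> l)\<^sup>2 - \<kappa>\<^sup>2 / (\<alpha> l)\<^sup>2) (polar_fun (radial_profile k \<kappa> (\<alpha> l) c d) m)"
    if "l \<ge> 1" "(c, d) \<noteq> (0, 0)" "boundary_system k \<kappa> (\<alpha> l) c d" "m \<in> {int k, - int k}" for l c d m
    using radial_profile_nontrivial[OF assms zero(2)[OF that(1)] that(1) _ that(2,3)] \<alpha>(3) that(1)
      is_eigenfunction_polar_fun[OF zero(1)[OF that(1)] assms that(3) _ _ _ that(4)] by blast
  have solution: "\<exists>c d. (c, d) \<noteq> (0, 0) \<and> boundary_system k \<kappa> (\<alpha> l) c d" if "l \<ge> 1" for l
    by (rule ex_boundary_system_solution[OF assms zero[OF that]])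
  have "is_eigenvalue \<kappa> ((\<alpha> l)\<^sup>2 - \<kappa>\<^sup>2 / (\<alpha> l)\<^sup>2)" if "l \<ge> 1" for l
    using solution[OF that] eigen[OF that] unfolding is_eigenvalue_def by blast
  with \<alpha> eigen solution show "\<exists>\<alpha> :: nat \<Rightarrow> real.
      strict_mono_on {1..} \<alpha> \<and>
      \<alpha> ` {1..} = {a. a > 0 \<and> F_fun k \<kappa> a = 0} \<and>
      (\<forall>l\<ge>1. bessel_J_root k l < \<alpha> l \<and> \<alpha> l < bessel_J_root (k + 1) l) \<and>
      (\<forall>l\<ge>1. is_eigenvalue \<kappa> ((\<alpha> l)\<^sup>2 - \<kappa>\<^sup>2 / (\<alpha> l)\<^sup>2) \<and>
         (\<exists>c d. (c, d) \<noteq> (0, 0) \<and> boundary_system k \<kappa> (\<alpha> l) c d) \<and>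
         (\<forall>c d. (c, d) \<noteq> (0, 0) \<and> boundary_system k \<kappa> (\<alpha> l) c d \<longrightarrow>
            (\<forall>m\<in>{int k, - int k}.
               is_eigenfunction \<kappa> ((\<alpha> l)\<^sup>2 - \<kappa>\<^sup>2 / (\<alpha> l)\<^sup>2)
                 (polar_fun (radial_profile k \<kappa> (\<alpha> l) c d) m))))"
    by (intro exI[of _ \<alpha>]) (simp add: atLeast_def)
qed

end
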